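(* Let $X$ be a non-empty topological space, let $\delta\ge 0$ and let $f,g\colon X\to\mathbb{R}$ be continuous functions with $|f(x)-g(x)|\le\delta$ for all $x\in X$. Then $h(f)$ and $h(g)$ are $\delta$-interleaved. More specifically, writing $a=(a_1,a_2):=\mathbf{d}(f,g)$ and $a':=(-a_2,-a_1)=\mathbf{d}(g,f)$, the interleaving natural transformations can be given as the compositions $$\varphi\colon h(g)\circ\Omega_\delta\xrightarrow{\,h(g)\circ\alpha_{a\preceq(-\delta,\delta)}\,}h(g)\circ\alpha_a\xrightarrow{\,\vec h(f,g)\,}h(f)$$ and $$\psi\colon h(f)\circ\Omega_\delta\xrightarrow{\,h(f)\circ\alpha_{a'\preceq(-\delta,\delta)}\,}h(f)\circ\alpha_{a'}\xrightarrow{\,\vec h(g,f)\,}h(g).$$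
   Context: Strip. $\mathbb{M}=\{(x,y)\in\mathbb{R}^2:-\pi\le x+y\le\pi\}$, ordered by $(x,y)\preceq(x',y')$ iff $x\ge x'$ and $y\le y'$; $l_0=\{x+y=-\pi\}$, $l_1=\{x+y=\pi\}$; $T(x,y)=(-\pi-y,\pi-x)$ is an automorphism of $\mathbb{M}$. $D=\{(x,y)\in\mathbb{M}:0\le x-y<2\pi\}$ is a fundamental domain for $\langle T\rangle\cong\mathbb{Z}$. For $u=(x,y)\in\mathbb{M}$ put $\rho_1(u)=\{t\in\mathbb{R}:-\pi-y<\arctan t<\pi-x\}$, $\rho_0(u)=\{t\in\mathbb{R}:\arctan t<y\text{ or }\arctan t>x\}$ and $\rho(u)=(\rho_1(u),\rho_0(u))$, a pair of open subsets of $\mathbb{R}$ with $\rho_0(u)\subseteq\rho_1(u)$. Cohomology. $K$ is a field and $\mathcal{H}^\bullet$ is a cohomology theory on pairs of spaces with values in $\mathbb{Z}$-graded $K$-vector spaces, sending weak equivalences to isomorphisms. For pairs $(X_i,A_i)$, $i=1,2$, of open subspaces of a space there is the relative Mayer–Vietoris sequence with differential $\mathcal{H}^{n-1}(X_1\cap X_2,A_1\cap A_2)\to\mathcal{H}^n(X_1\cup X_2,A_1\cup A_2)$ (one fixed sign convention). For an axis-aligned rectangle with lower right corner $p$ and upper left corner $w$, and a monotone assignment of open pairs preserving the corresponding join $w$ (union) and meet $p$ (intersection), "the Mayer–Vietoris differential of the rectangle" is the one for the pairs assigned to the lower left corner (index 1) and the upper right corner (index 2). The functor $h(f)$. For continuous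 $f\colon X\to\mathbb{R}$, with $f^{-1}(U,V)=(f^{-1}(U),f^{-1}(V))$, the contravariant functor $h(f)\colon\mathbb{M}^\circ\to\mathrm{Vect}_K$ is: $h(f)(u)=\mathcal{H}^n(f^{-1}(\rho(T^n(u))))$ for $u\in T^{-n}(D)$. For $u\preceq v$ the internal map $h(f)(u\preceq v)\colon h(f)(v)\to h(f)(u)$ is: the map induced by inclusion if $u,v\in T^{-n}(D)$ for some $n$; if $u\in T^{-n}(D)$, $v\in T^{-n+1}(D)$ and $v\preceq T(u)$, the Mayer–Vietoris differential $\mathcal{H}^{n-1}(f^{-1}(\rho(p)))\to\mathcal{H}^n(f^{-1}(\rho(w)))$ of the axis-aligned rectangle in $D$ with lower right corner $p=T^{n-1}(v)$ and upper left corner $w=T^n(u)$, via $f^{-1}\circ\rho$; and $0$ in all other cases. The automorphisms $\alpha_a$. $\mathbb{R}^\circ\times\mathbb{R}$ is $\mathbb{R}^2$ ordered by $(x,y)\preceq(x',y')$ iff $x\ge x'$ and $y\le y'$. $\alpha\colon\mathbb{R}^2\to\operatorname{Aut}(\mathbb{M})$, $a\mapsto\alpha_a$, is the unique group homomorphism into the lattice automorphisms of $\mathbb{M}$ with $\alpha_{(a_1,a_2)}(0,0)=(\arctan a_1,\arctan a_2)$. Explicitly $\alpha_a(x,y)=(\pi-\tilde g_a(\pi-x),\tilde g_a(y))$, where $\tilde g_a\colon\mathbb{R}\to\mathbb{R}$ is the continuous map with $\tilde g_a(\theta+2\pi)=\tilde g_a(\theta)+2\pi$, $\tilde g_a(\theta)=\arctan(\tan\theta+a_2)$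 on $(-\pi/2,\pi/2)$, $\tilde g_a(\theta)=\pi+\arctan(\tan\theta-a_1)$ on $(\pi/2,3\pi/2)$, and $\tilde g_a$ fixes $\pi/2+\pi\mathbb{Z}$ pointwise. $\alpha$ is monotone and each $\alpha_a$ commutes with $T$. For $b\preceq a$ and $F\colon\mathbb{M}^\circ\to\mathrm{Vect}_K$, $F\circ\alpha_{b\preceq a}\colon F\circ\alpha_a\to F\circ\alpha_b$ has component $F(\alpha_b(u)\preceq\alpha_a(u))$ at $u$. Put $\Omega_\delta=\alpha_{(-\delta,\delta)}$; $\Omega_0=\operatorname{id}$ and $\Omega_{0\preceq2\delta}$ is $\alpha_{0\preceq(-2\delta,2\delta)}$. The transformation $\vec h$. $\mathbf{d}(f,g)=(\inf(g-f),\sup(g-f))$. If $a=\mathbf{d}(f,g)$ is finite, $\vec h(f,g)\colon h(g)\circ\alpha_a\to h(f)$ is the natural transformation defined as follows. Let $E=\alpha_{-a}(D)$; then $D\subseteq E\cup T(E)$. For $u\in T^{-n}(D)$ let $p=T^n(u)\in D$. If $p\in E$, then $\vec h(f,g)_u\colon\mathcal{H}^n(g^{-1}(\rho(\alpha_a(p))))\to\mathcal{H}^n(f^{-1}(\rho(p)))$ is induced by inclusion. If $p\in T(E)$, put $\xi(q)=(g^{-1}(\rho_1(\alpha_a(q))),f^{-1}(\rho_0(q)))$; then $\xi(p)=f^{-1}(\rho(p))$ and $\xi(T^{-1}(p))=g^{-1}(\rho(\alpha_a(T^{-1}(p))))$, and $\vec h(f,g)_u\colon\mathcal{H}^{n-1}(\xi(T^{-1}(p)))\to\mathcal{H}^n(\xi(p))$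 is the Mayer–Vietoris differential, via $\xi$, of the axis-aligned rectangle with upper left corner $p$ and lower right corner $T^{-1}(p)$ (whose other two corners lie on $\partial\mathbb{M}=l_0\cup l_1$). Interleavings. For $\delta\ge0$ and $F,G\colon\mathbb{M}^\circ\to\mathrm{Vect}_K$, a $\delta$-interleaving is a pair of natural transformations $\varphi\colon G\circ\Omega_\delta\to F$, $\psi\colon F\circ\Omega_\delta\to G$ such that $\varphi\circ(\psi\circ\Omega_\delta)=F\circ\Omega_{0\preceq2\delta}\colon F\circ\Omega_{2\delta}\to F$ and $\psi\circ(\varphi\circ\Omega_\delta)=G\circ\Omega_{0\preceq2\delta}\colon G\circ\Omega_{2\delta}\to G$. $F,G$ are $\delta$-interleaved if a $\delta$-interleaving exists. *)

theory Defs
  imports "HOL-Analysis.Analysis" "HOL-Algebra.Module"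
begin

section \<open>Vector spaces\<close>

text \<open>A \<open>K\<close>-vector space is a \<open>K\<close>-module in the sense of \<open>HOL-Algebra\<close>, with \<open>K\<close> a field.
  Linear maps are only relevant on carriers.\<close>

definition linear_map ::
    "('k, 'm) ring_scheme \<Rightarrow> ('k, 'v) module \<Rightarrow> ('k, 'v) module \<Rightarrow> ('v \<Rightarrow> 'v) \<Rightarrow> bool" where
  "linear_map K V W \<phi> \<longleftrightarrow>
     \<phi> \<in> carrier V \<rightarrow> carrier W \<and>
     (\<forall>x\<in>carrier V. \<forall>y\<in>carrier V. \<phi> (x \<oplus>\<^bsub>V\<^esub> y) = \<phi> x \<oplus>\<^bsub>W\<^esub> \<phi> y) \<and>
     (\<forall>c\<in>carrier K. \<forall>x\<in>carrier V. \<phi> (c \<odot>\<^bsub>V\<^esub> x) = c \<odot>\<^bsub>W\<^esub> \<phi> x)"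

section \<open>Homotopy groups and weak equivalences\<close>

definition cube :: "nat \<Rightarrow> (nat \<Rightarrow> real) topology" where
  "cube n = product_topology (\<lambda>_. top_of_set {0..1}) {..<n}"

definition cube_boundary :: "nat \<Rightarrow> (nat \<Rightarrow> real) set" where
  "cube_boundary n = {t \<in> topspace (cube n). \<exists>i<n. t i = 0 \<or> t i = 1}"

text \<open>Maps \<open>(I\<^sup>n, \<partial>I\<^sup>n) \<rightarrow> (X, x)\<close>; for \<open>n = 0\<close> the boundary is empty and these are the points
  of \<open>X\<close>, so that \<open>pi_set 0 X x\<close> is the set of path components.\<close>

definition cube_loops :: "nat \<Rightarrow> 'a topology \<Rightarrow> 'a \<Rightarrow> ((nat \<Rightarrow> real) \<Rightarrow> 'a) set" where
  "cube_loops n X x = {p. continuous_map (cube n) X p \<and> p ` cube_boundary n \<subseteq> {x}}"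

definition loop_rel :: "nat \<Rightarrow> 'a topology \<Rightarrow> 'a \<Rightarrow> (((nat \<Rightarrow> real) \<Rightarrow> 'a) \<times> ((nat \<Rightarrow> real) \<Rightarrow> 'a)) set" where
  "loop_rel n X x = {(p, q). p \<in> cube_loops n X x \<and> q \<in> cube_loops n X x \<and>
      homotopic_with (\<lambda>r. r ` cube_boundary n \<subseteq> {x}) (cube n) X p q}"

definition pi_set :: "nat \<Rightarrow> 'a topology \<Rightarrow> 'a \<Rightarrow> ((nat \<Rightarrow> real) \<Rightarrow> 'a) set set" where
  "pi_set n X x = cube_loops n X x // loop_rel n X x"

definition pi_map :: "nat \<Rightarrow> 'a topology \<Rightarrow> 'a \<Rightarrow> ('a \<Rightarrow> 'a)
    \<Rightarrow> ((nat \<Rightarrow> real) \<Rightarrow> 'a) set \<Rightarrow> ((nat \<Rightarrow> real) \<Rightarrow> 'a) set" where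
  "pi_map n Y x \<phi> c = loop_rel n Y (\<phi> x) `` ((\<lambda>p. \<phi> \<circ> p) ` c)"

definition weak_equivalence :: "'a topology \<Rightarrow> 'a topology \<Rightarrow> ('a \<Rightarrow> 'a) \<Rightarrow> bool" where
  "weak_equivalence X Y \<phi> \<longleftrightarrow>
     continuous_map X Y \<phi> \<and>
     (topspace X = {} \<longrightarrow> topspace Y = {}) \<and>
     (\<forall>n. \<forall>x\<in>topspace X. bij_betw (pi_map n Y x \<phi>) (pi_set n X x) (pi_set n Y (\<phi> x)))"

section \<open>Cohomology theories on pairs of spaces\<close>

type_synonym 'a space_pair = "'a topology \<times> 'a set"

definition is_pair :: "'a space_pair \<Rightarrow> bool" where
  "is_pair P \<longleftrightarrow> snd P \<subseteq> topspace (fst P)"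

definition pair_map :: "'a space_pair \<Rightarrow> 'a space_pair \<Rightarrow> ('a \<Rightarrow> 'a) \<Rightarrow> bool" where
  "pair_map P Q \<phi> \<longleftrightarrow> is_pair P \<and> is_pair Q \<and>
     continuous_map (fst P) (fst Q) \<phi> \<and> \<phi> ` snd P \<subseteq> snd Q"

definition weak_equivalence_pair :: "'a space_pair \<Rightarrow> 'a space_pair \<Rightarrow> ('a \<Rightarrow> 'a) \<Rightarrow> bool" where
  "weak_equivalence_pair P Q \<phi> \<longleftrightarrow> pair_map P Q \<phi> \<and>
     weak_equivalence (fst P) (fst Q) \<phi> \<and>
     weak_equivalence (subtopology (fst P) (snd P)) (subtopology (fst Q) (snd Q)) \<phi>"

text \<open>A pair of subsets \<open>(U, V)\<close> of a space, regarded as a pair of subspaces.\<close>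

definition sub_pair :: "'a topology \<Rightarrow> 'a set \<times> 'a set \<Rightarrow> 'a space_pair" where
  "sub_pair Y P = (subtopology Y (fst P), snd P)"

definition pair_un :: "'a set \<times> 'a set \<Rightarrow> 'a set \<times> 'a set \<Rightarrow> 'a set \<times> 'a set" where
  "pair_un P Q = (fst P \<union> fst Q, snd P \<union> snd Q)"

definition pair_int :: "'a set \<times> 'a set \<Rightarrow> 'a set \<times> 'a set \<Rightarrow> 'a set \<times> 'a set" where
  "pair_int P Q = (fst P \<inter> fst Q, snd P \<inter> snd Q)"

definition open_pair :: "'a topology \<Rightarrow> 'a set \<times> 'a set \<Rightarrow> bool" where
  "open_pair Y P \<longleftrightarrow> openin Y (fst P) \<and> openin Y (snd P) \<and> snd P \<subseteq> fst P"

text \<open>\<open>coh C n P\<close> is the degree-\<open>n\<close> cohomology \<open>H\<^sup>n(P)\<close>, and for \<open>\<phi> : P \<rightarrow> Q\<close> the map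
  \<open>coh_map C n P Q \<phi>\<close> goes from \<open>H\<^sup>n(Q)\<close> to \<open>H\<^sup>n(P)\<close>.  The coboundary
  \<open>coboundary C n (X, A)\<close> goes from \<open>H\<^sup>n(A)\<close> to \<open>H\<^sup>n\<^sup>+\<^sup>1(X, A)\<close>.  For pairs
  \<open>P = (X\<^sub>1, A\<^sub>1)\<close> and \<open>Q = (X\<^sub>2, A\<^sub>2)\<close> of open subsets of \<open>Y\<close>, the Mayer--Vietoris
  differential \<open>mv_diff C n Y P Q\<close> goes from \<open>H\<^sup>n\<^sup>-\<^sup>1(X\<^sub>1 \<inter> X\<^sub>2, A\<^sub>1 \<inter> A\<^sub>2)\<close> to
  \<open>H\<^sup>n(X\<^sub>1 \<union> X\<^sub>2, A\<^sub>1 \<union> A\<^sub>2)\<close>.\<close>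

record ('a, 'k, 'v) cohomology =
  coh :: "int \<Rightarrow> 'a space_pair \<Rightarrow> ('k, 'v) module"
  coh_map :: "int \<Rightarrow> 'a space_pair \<Rightarrow> 'a space_pair \<Rightarrow> ('a \<Rightarrow> 'a) \<Rightarrow> 'v \<Rightarrow> 'v"
  coboundary :: "int \<Rightarrow> 'a space_pair \<Rightarrow> 'v \<Rightarrow> 'v"
  mv_diff :: "int \<Rightarrow> 'a topology \<Rightarrow> 'a set \<times> 'a set \<Rightarrow> 'a set \<times> 'a set \<Rightarrow> 'v \<Rightarrow> 'v"

text \<open>The Eilenberg--Steenrod axioms without the dimension axiom, together with invariance under
  weak equivalences.  The spaces are those whose points have type \<open>'a\<close>; a theory defined on all
  spaces restricts to one of these.\<close>

locale cohomology_theory =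
  fixes K :: "('k, 'm) ring_scheme" and C :: "('a, 'k, 'v) cohomology"
  assumes vector_spaces: "is_pair P \<Longrightarrow> Module.module K (coh C n P)"
    and coh_map_linear:
      "pair_map P Q \<phi> \<Longrightarrow> linear_map K (coh C n Q) (coh C n P) (coh_map C n P Q \<phi>)"
    and coh_map_id:
      "is_pair P \<Longrightarrow> z \<in> carrier (coh C n P) \<Longrightarrow> coh_map C n P P (\<lambda>x. x) z = z"
    and coh_map_comp:
      "pair_map P Q \<phi> \<Longrightarrow> pair_map Q R \<psi> \<Longrightarrow> z \<in> carrier (coh C n R) \<Longrightarrow>
       coh_map C n P R (\<psi> \<circ> \<phi>) z = coh_map C n P Q \<phi> (coh_map C n Q R \<psi> z)"
    and homotopy_invariance:
      "pair_map P Q \<phi> \<Longrightarrow> pair_map P Q \<psi> \<Longrightarrow>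
       homotopic_with (\<lambda>\<theta>. \<theta> ` snd P \<subseteq> snd Q) (fst P) (fst Q) \<phi> \<psi> \<Longrightarrow>
       z \<in> carrier (coh C n Q) \<Longrightarrow> coh_map C n P Q \<phi> z = coh_map C n P Q \<psi> z"
    and coboundary_linear:
      "is_pair (X, A) \<Longrightarrow>
       linear_map K (coh C n (subtopology X A, {})) (coh C (n + 1) (X, A)) (coboundary C n (X, A))"
    and coboundary_natural:
      "pair_map (X, A) (Y, B) \<phi> \<Longrightarrow> z \<in> carrier (coh C n (subtopology Y B, {})) \<Longrightarrow>
       coh_map C (n + 1) (X, A) (Y, B) \<phi> (coboundary C n (Y, B) z) =
       coboundary C n (X, A) (coh_map C n (subtopology X A, {}) (subtopology Y B, {}) \<phi> z)"
    and exact_space: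
      "is_pair (X, A) \<Longrightarrow>
       {z \<in> carrier (coh C n (X, {})).
          coh_map C n (subtopology X A, {}) (X, {}) (\<lambda>x. x) z = \<zero>\<^bsub>coh C n (subtopology X A, {})\<^esub>} =
       coh_map C n (X, {}) (X, A) (\<lambda>x. x) ` carrier (coh C n (X, A))"
    and exact_subspace:
      "is_pair (X, A) \<Longrightarrow>
       {z \<in> carrier (coh C n (subtopology X A, {})).
          coboundary C n (X, A) z = \<zero>\<^bsub>coh C (n + 1) (X, A)\<^esub>} =
       coh_map C n (subtopology X A, {}) (X, {}) (\<lambda>x. x) ` carrier (coh C n (X, {}))"
    and exact_pair:
      "is_pair (X, A) \<Longrightarrow>
       {z \<in> carrier (coh C (n + 1) (X, A)).
          coh_map C (n + 1) (X, {}) (X, A) (\<lambda>x. x) z = \<zero>\<^bsub>coh C (n + 1) (X, {})\<^esub>} =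
       coboundary C n (X, A) ` carrier (coh C n (subtopology X A, {}))"
    and excision:
      "is_pair (X, A) \<Longrightarrow> U \<subseteq> topspace X \<Longrightarrow> X closure_of U \<subseteq> X interior_of A \<Longrightarrow>
       bij_betw (coh_map C n (subtopology X (topspace X - U), A - U) (X, A) (\<lambda>x. x))
         (carrier (coh C n (X, A)))
         (carrier (coh C n (subtopology X (topspace X - U), A - U)))"
    and weak_equivalence_iso:
      "weak_equivalence_pair P Q \<phi> \<Longrightarrow>
       bij_betw (coh_map C n P Q \<phi>) (carrier (coh C n Q)) (carrier (coh C n P))"

text \<open>The relative Mayer--Vietoris sequence of pairs \<open>P\<close>, \<open>Q\<close> of open subspaces,
  \<open>H\<^sup>n\<^sup>-\<^sup>1(P) \<oplus> H\<^sup>n\<^sup>-\<^sup>1(Q) \<rightarrow> H\<^sup>n\<^sup>-\<^sup>1(P \<inter> Q) \<rightarrow> H\<^sup>n(P \<union> Q) \<rightarrow> H\<^sup>n(P) \<oplus> H\<^sup>n(Q) \<rightarrow> H\<^sup>n(P \<inter> Q)\<close>: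
  it is natural and exact, and in the absolute case its differential is, up to the sign fixed by
  the convention, the composite
  \<open>H\<^sup>n\<^sup>-\<^sup>1(X\<^sub>1 \<inter> X\<^sub>2) \<rightarrow> H\<^sup>n(X\<^sub>1, X\<^sub>1 \<inter> X\<^sub>2) \<cong> H\<^sup>n(X\<^sub>1 \<union> X\<^sub>2, X\<^sub>2) \<rightarrow> H\<^sup>n(X\<^sub>1 \<union> X\<^sub>2)\<close> of the
  coboundary, the inverse of excision, and the restriction.\<close>

locale relative_mayer_vietoris =
  fixes K :: "('k, 'm) ring_scheme" and C :: "('a, 'k, 'v) cohomology"
  assumes mv_linear:
      "open_pair Y P \<Longrightarrow> open_pair Y Q \<Longrightarrow>
       linear_map K (coh C (n - 1) (sub_pair Y (pair_int P Q)))
         (coh C n (sub_pair Y (pair_un P Q))) (mv_diff C n Y P Q)"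
    and mv_natural:
      "open_pair Y P \<Longrightarrow> open_pair Y Q \<Longrightarrow> open_pair Y' P' \<Longrightarrow> open_pair Y' Q' \<Longrightarrow>
       continuous_map (subtopology Y (fst P \<union> fst Q)) (subtopology Y' (fst P' \<union> fst Q')) \<phi> \<Longrightarrow>
       \<phi> ` fst P \<subseteq> fst P' \<Longrightarrow> \<phi> ` snd P \<subseteq> snd P' \<Longrightarrow>
       \<phi> ` fst Q \<subseteq> fst Q' \<Longrightarrow> \<phi> ` snd Q \<subseteq> snd Q' \<Longrightarrow>
       z \<in> carrier (coh C (n - 1) (sub_pair Y' (pair_int P' Q'))) \<Longrightarrow>
       coh_map C n (sub_pair Y (pair_un P Q)) (sub_pair Y' (pair_un P' Q')) \<phi>
         (mv_diff C n Y' P' Q' z) =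
       mv_diff C n Y P Q
         (coh_map C (n - 1) (sub_pair Y (pair_int P Q)) (sub_pair Y' (pair_int P' Q')) \<phi> z)"
    and mv_exact_int:
      "open_pair Y P \<Longrightarrow> open_pair Y Q \<Longrightarrow>
       {z \<in> carrier (coh C (n - 1) (sub_pair Y (pair_int P Q))).
          mv_diff C n Y P Q z = \<zero>\<^bsub>coh C n (sub_pair Y (pair_un P Q))\<^esub>} =
       {coh_map C (n - 1) (sub_pair Y (pair_int P Q)) (sub_pair Y P) (\<lambda>x. x) s
          \<ominus>\<^bsub>coh C (n - 1) (sub_pair Y (pair_int P Q))\<^esub>
        coh_map C (n - 1) (sub_pair Y (pair_int P Q)) (sub_pair Y Q) (\<lambda>x. x) t | s t.
          s \<in> carrier (coh C (n - 1) (sub_pair Y P)) \<and>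
          t \<in> carrier (coh C (n - 1) (sub_pair Y Q))}"
    and mv_exact_un:
      "open_pair Y P \<Longrightarrow> open_pair Y Q \<Longrightarrow>
       {w \<in> carrier (coh C n (sub_pair Y (pair_un P Q))).
          coh_map C n (sub_pair Y P) (sub_pair Y (pair_un P Q)) (\<lambda>x. x) w = \<zero>\<^bsub>coh C n (sub_pair Y P)\<^esub> \<and>
          coh_map C n (sub_pair Y Q) (sub_pair Y (pair_un P Q)) (\<lambda>x. x) w = \<zero>\<^bsub>coh C n (sub_pair Y Q)\<^esub>} =
       mv_diff C n Y P Q ` carrier (coh C (n - 1) (sub_pair Y (pair_int P Q)))"
    and mv_exact_sum:
      "open_pair Y P \<Longrightarrow> open_pair Y Q \<Longrightarrow>
       {(s, t). s \<in> carrier (coh C n (sub_pair Y P)) \<and> t \<in> carrier (coh C n (sub_pair Y Q)) \<and>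
          coh_map C n (sub_pair Y (pair_int P Q)) (sub_pair Y P) (\<lambda>x. x) s =
          coh_map C n (sub_pair Y (pair_int P Q)) (sub_pair Y Q) (\<lambda>x. x) t} =
       (\<lambda>w. (coh_map C n (sub_pair Y P) (sub_pair Y (pair_un P Q)) (\<lambda>x. x) w,
             coh_map C n (sub_pair Y Q) (sub_pair Y (pair_un P Q)) (\<lambda>x. x) w)) `
         carrier (coh C n (sub_pair Y (pair_un P Q)))"
    and mv_absolute:
      "\<exists>\<epsilon>\<in>{\<one>\<^bsub>K\<^esub>, \<ominus>\<^bsub>K\<^esub> \<one>\<^bsub>K\<^esub>}. \<forall>Y X1 X2.
         openin Y X1 \<longrightarrow> openin Y X2 \<longrightarrow>
         (\<forall>z\<in>carrier (coh C (n - 1) (subtopology Y (X1 \<inter> X2), {})).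
          \<forall>y\<in>carrier (coh C n (subtopology Y (X1 \<union> X2), X2)).
            coh_map C n (subtopology Y X1, X1 \<inter> X2) (subtopology Y (X1 \<union> X2), X2) (\<lambda>x. x) y =
              coboundary C (n - 1) (subtopology Y X1, X1 \<inter> X2) z \<longrightarrow>
            mv_diff C n Y (X1, {}) (X2, {}) z =
              \<epsilon> \<odot>\<^bsub>coh C n (subtopology Y (X1 \<union> X2), {})\<^esub>
                coh_map C n (subtopology Y (X1 \<union> X2), {}) (subtopology Y (X1 \<union> X2), X2) (\<lambda>x. x) y)"

section \<open>The strip\<close>

text \<open>The order both of the strip and of \<open>\<real>\<^sup>\<circ> \<times> \<real>\<close>.\<close>

definition strip_le :: "real \<times> real \<Rightarrow> real \<times> real \<Rightarrow> bool" (infix "\<preceq>" 50) where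
  "u \<preceq> v \<longleftrightarrow> fst v \<le> fst u \<and> snd u \<le> snd v"

definition strip :: "(real \<times> real) set" where
  "strip = {(x, y). - pi \<le> x + y \<and> x + y \<le> pi}"

definition strip_T :: "real \<times> real \<Rightarrow> real \<times> real" where
  "strip_T u = (- pi - snd u, pi - fst u)"

definition strip_T_inv :: "real \<times> real \<Rightarrow> real \<times> real" where
  "strip_T_inv u = (pi - snd u, - pi - fst u)"

definition strip_T_pow :: "int \<Rightarrow> real \<times> real \<Rightarrow> real \<times> real" where
  "strip_T_pow n = (if 0 \<le> n then strip_T ^^ nat n else strip_T_inv ^^ nat (- n))"

definition fund_D :: "(real \<times> real) set" where
  "fund_D = {(x, y) \<in> strip. 0 \<le> x - y \<and> x - y < 2 * pi}"

text \<open>The unique \<open>n\<close> with \<open>u \<in> T\<^sup>-\<^sup>n(D)\<close>.\<close>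

definition tile :: "real \<times> real \<Rightarrow> int" where
  "tile u = (THE n. strip_T_pow n u \<in> fund_D)"

definition rho1 :: "real \<times> real \<Rightarrow> real set" where
  "rho1 u = {t. - pi - snd u < arctan t \<and> arctan t < pi - fst u}"

definition rho0 :: "real \<times> real \<Rightarrow> real set" where
  "rho0 u = {t. arctan t < snd u \<or> arctan t > fst u}"

definition rho :: "real \<times> real \<Rightarrow> real set \<times> real set" where
  "rho u = (rho1 u, rho0 u)"

definition preimage_pair ::
    "'a topology \<Rightarrow> ('a \<Rightarrow> real) \<Rightarrow> real set \<times> real set \<Rightarrow> 'a set \<times> 'a set" where
  "preimage_pair X f P = ({x \<in> topspace X. f x \<in> fst P}, {x \<in> topspace X. f x \<in> snd P})"

section \<open>Functors on the strip\<close>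

text \<open>For \<open>u \<preceq> v\<close> the internal map \<open>fmap F u v\<close> goes from \<open>fobj F v\<close> to \<open>fobj F u\<close>.\<close>

record ('k, 'v) strip_functor =
  fobj :: "real \<times> real \<Rightarrow> ('k, 'v) module"
  fmap :: "real \<times> real \<Rightarrow> real \<times> real \<Rightarrow> 'v \<Rightarrow> 'v"

definition is_strip_functor :: "('k, 'm) ring_scheme \<Rightarrow> ('k, 'v) strip_functor \<Rightarrow> bool" where
  "is_strip_functor K F \<longleftrightarrow>
     (\<forall>u\<in>strip. Module.module K (fobj F u)) \<and>
     (\<forall>u\<in>strip. \<forall>v\<in>strip. u \<preceq> v \<longrightarrow> linear_map K (fobj F v) (fobj F u) (fmap F u v)) \<and>
     (\<forall>u\<in>strip. \<forall>z\<in>carrier (fobj F u). fmap F u u z = z) \<and>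
     (\<forall>u\<in>strip. \<forall>v\<in>strip. \<forall>w\<in>strip. u \<preceq> v \<longrightarrow> v \<preceq> w \<longrightarrow>
        (\<forall>z\<in>carrier (fobj F w). fmap F u w z = fmap F u v (fmap F v w z)))"

definition precompose ::
    "('k, 'v) strip_functor \<Rightarrow> (real \<times> real \<Rightarrow> real \<times> real) \<Rightarrow> ('k, 'v) strip_functor" where
  "precompose F \<beta> = \<lparr>fobj = (\<lambda>u. fobj F (\<beta> u)), fmap = (\<lambda>u v. fmap F (\<beta> u) (\<beta> v))\<rparr>"

type_synonym 'v transformation = "real \<times> real \<Rightarrow> 'v \<Rightarrow> 'v"

definition natural_transformation ::
    "('k, 'm) ring_scheme \<Rightarrow> ('k, 'v) strip_functor \<Rightarrow> ('k, 'v) strip_functor \<Rightarrow>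
     'v transformation \<Rightarrow> bool" where
  "natural_transformation K F G \<eta> \<longleftrightarrow>
     is_strip_functor K F \<and> is_strip_functor K G \<and>
     (\<forall>u\<in>strip. linear_map K (fobj F u) (fobj G u) (\<eta> u)) \<and>
     (\<forall>u\<in>strip. \<forall>v\<in>strip. u \<preceq> v \<longrightarrow>
        (\<forall>z\<in>carrier (fobj F v). \<eta> u (fmap F u v z) = fmap G u v (\<eta> v z)))"

definition nt_comp :: "'v transformation \<Rightarrow> 'v transformation \<Rightarrow> 'v transformation" where
  "nt_comp \<eta> \<theta> = (\<lambda>u. \<eta> u \<circ> \<theta> u)"

definition whisker :: "'v transformation \<Rightarrow> (real \<times> real \<Rightarrow> real \<times> real) \<Rightarrow> 'v transformation" where
  "whisker \<eta> \<beta> = (\<lambda>u. \<eta> (\<beta> u))"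

text \<open>Equality of transformations with source \<open>F\<close>.\<close>

definition nt_eq :: "('k, 'v) strip_functor \<Rightarrow> 'v transformation \<Rightarrow> 'v transformation \<Rightarrow> bool" where
  "nt_eq F \<eta> \<theta> \<longleftrightarrow> (\<forall>u\<in>strip. \<forall>z\<in>carrier (fobj F u). \<eta> u z = \<theta> u z)"

section \<open>The functor \<open>h(f)\<close>\<close>

text \<open>The Mayer--Vietoris differential of the axis-aligned rectangle with lower right corner \<open>p\<close>
  and upper left corner \<open>w\<close>, for an assignment \<open>\<Xi>\<close> of pairs of subsets of \<open>X\<close>.  The first pair
  is the one at the lower left corner.\<close>

definition mv_rect ::
    "('a, 'k, 'v) cohomology \<Rightarrow> int \<Rightarrow> 'a topology \<Rightarrow> (real \<times> real \<Rightarrow> 'a set \<times> 'a set) \<Rightarrow>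
     real \<times> real \<Rightarrow> real \<times> real \<Rightarrow> 'v \<Rightarrow> 'v" where
  "mv_rect C n X \<Xi> p w = mv_diff C n X (\<Xi> (fst w, snd p)) (\<Xi> (fst p, snd w))"

definition h :: "('a, 'k, 'v) cohomology \<Rightarrow> 'a topology \<Rightarrow> ('a \<Rightarrow> real) \<Rightarrow> ('k, 'v) strip_functor" where
  "h C X f =
    (let \<Xi> = (\<lambda>p. preimage_pair X f (rho p));
         ob = (\<lambda>u. coh C (tile u) (sub_pair X (\<Xi> (strip_T_pow (tile u) u))))
     in \<lparr>fobj = ob,
         fmap = (\<lambda>u v. let n = tile u in
           if tile v = n then
             coh_map C n (sub_pair X (\<Xi> (strip_T_pow n u))) (sub_pair X (\<Xi> (strip_T_pow n v))) (\<lambda>x. x)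
           else if tile v = n - 1 \<and> v \<preceq> strip_T u then
             mv_rect C n X \<Xi> (strip_T_pow (n - 1) v) (strip_T_pow n u)
           else (\<lambda>z. \<zero>\<^bsub>ob u\<^esub>))\<rparr>)"

section \<open>The automorphisms \<open>\<alpha>\<^sub>a\<close>\<close>

text \<open>With \<open>r\<close> the representative of \<open>\<theta>\<close> modulo \<open>2\<pi>\<close> in \<open>[-\<pi>/2, 3\<pi>/2)\<close>.\<close>

definition g_tilde :: "real \<times> real \<Rightarrow> real \<Rightarrow> real" where
  "g_tilde a \<theta> =
    (let k = \<lfloor>(\<theta> + pi / 2) / (2 * pi)\<rfloor>; r = \<theta> - 2 * pi * of_int k in
     if r = - pi / 2 \<or> r = pi / 2 then \<theta>
     else if r < pi / 2 then arctan (tan r + snd a) + 2 * pi * of_int k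
     else pi + arctan (tan r - fst a) + 2 * pi * of_int k)"

definition alpha :: "real \<times> real \<Rightarrow> real \<times> real \<Rightarrow> real \<times> real" where
  "alpha a u = (pi - g_tilde a (pi - fst u), g_tilde a (snd u))"

text \<open>For \<open>b \<preceq> a\<close>, the transformation \<open>F \<circ> \<alpha>\<^bsub>b \<preceq> a\<^esub>\<close> from \<open>F \<circ> \<alpha>\<^sub>a\<close> to \<open>F \<circ> \<alpha>\<^sub>b\<close>.\<close>

definition alpha_trans ::
    "('k, 'v) strip_functor \<Rightarrow> real \<times> real \<Rightarrow> real \<times> real \<Rightarrow> 'v transformation" where
  "alpha_trans F b a = (\<lambda>u. fmap F (alpha b u) (alpha a u))"

definition Omega :: "real \<Rightarrow> real \<times> real \<Rightarrow> real \<times> real" where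
  "Omega \<delta> = alpha (- \<delta>, \<delta>)"

definition dist_pair :: "'a topology \<Rightarrow> ('a \<Rightarrow> real) \<Rightarrow> ('a \<Rightarrow> real) \<Rightarrow> real \<times> real" where
  "dist_pair X f g = ((INF x\<in>topspace X. g x - f x), (SUP x\<in>topspace X. g x - f x))"

section \<open>The transformation from \<open>h(g) \<circ> \<alpha>\<^sub>a\<close> to \<open>h(f)\<close>\<close>

text \<open>Since \<open>D \<subseteq> E \<union> T(E)\<close>, the second branch is the case \<open>p \<in> T(E)\<close>.  The rectangle there has
  lower right corner \<open>T\<^sup>-\<^sup>1(p)\<close>, upper left corner \<open>p\<close>, and its other two corners on the boundary
  of the strip.\<close>

definition vec_h ::
    "('a, 'k, 'v) cohomology \<Rightarrow> 'a topology \<Rightarrow> ('a \<Rightarrow> real) \<Rightarrow> ('a \<Rightarrow> real) \<Rightarrow> 'v transformation" where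
  "vec_h C X f g = (\<lambda>u.
    let a = dist_pair X f g;
        E = alpha (- fst a, - snd a) ` fund_D;
        n = tile u;
        p = strip_T_pow n u;
        \<xi> = (\<lambda>q. ({x \<in> topspace X. g x \<in> rho1 (alpha a q)}, {x \<in> topspace X. f x \<in> rho0 q}))
    in if p \<in> E then
         coh_map C n (sub_pair X (preimage_pair X f (rho p)))
           (sub_pair X (preimage_pair X g (rho (alpha a p)))) (\<lambda>x. x)
       else mv_rect C n X \<xi> (strip_T_inv p) p)"

section \<open>Interleavings\<close>

definition interleaving ::
    "('k, 'm) ring_scheme \<Rightarrow> real \<Rightarrow> ('k, 'v) strip_functor \<Rightarrow> ('k, 'v) strip_functor \<Rightarrow>
     'v transformation \<Rightarrow> 'v transformation \<Rightarrow> bool" where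
  "interleaving K \<delta> F G \<phi> \<psi> \<longleftrightarrow>
     natural_transformation K (precompose G (Omega \<delta>)) F \<phi> \<and>
     natural_transformation K (precompose F (Omega \<delta>)) G \<psi> \<and>
     nt_eq (precompose F (Omega (2 * \<delta>)))
       (nt_comp \<phi> (whisker \<psi> (Omega \<delta>))) (alpha_trans F (0, 0) (- (2 * \<delta>), 2 * \<delta>)) \<and>
     nt_eq (precompose G (Omega (2 * \<delta>)))
       (nt_comp \<psi> (whisker \<phi> (Omega \<delta>))) (alpha_trans G (0, 0) (- (2 * \<delta>), 2 * \<delta>))"

definition interleaved ::
    "('k, 'm) ring_scheme \<Rightarrow> real \<Rightarrow> ('k, 'v) strip_functor \<Rightarrow> ('k, 'v) strip_functor \<Rightarrow> bool" where
  "interleaved K \<delta> F G \<longleftrightarrow> (\<exists>\<phi> \<psi>. interleaving K \<delta> F G \<phi> \<psi>)"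

end

theory Submission
  imports Defs
begin

text \<open>Every composite of structure maps that raises the degree by one is a Mayer--Vietoris
  differential of some cover \<open>(P, Q)\<close>, restricted from a pair \<open>R \<supseteq> P \<inter> Q\<close> and to a pair
  \<open>W \<subseteq> P \<union> Q\<close>. By naturality two covers yield the same map if
  \<open>W \<subseteq> (P \<inter> P') \<union> (Q \<inter> Q')\<close> or \<open>(P \<inter> Q') \<union> (P' \<inter> Q) \<subseteq> R\<close>, and by exactness the
  map vanishes if \<open>W\<close> is contained in \<open>P\<close> or \<open>Q\<close>, or \<open>R\<close> contains one of them. This turns
  functoriality of \<open>h\<close>, naturality of \<open>vec_h\<close>, and the identity expressing
  \<open>vec_h(f,g)\<^sub>u \<circ> vec_h(g,f)\<close> at \<open>\<alpha>\<^sub>a(u)\<close> as an internal map of \<open>h(f)\<close> into pointwise linear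
  inequalities between \<open>arctan (f x)\<close>, \<open>arctan (g x)\<close> and the coordinates of points of the strip.
  The interleaving identities follow because \<open>\<alpha>\<close> is a homomorphism.\<close>

text \<open>The obstacle is that \<open>alpha a\<close> does not preserve \<open>fund_D\<close>: of
  two neighbouring components of \<open>vec_h\<close>, one may be a restriction and the other a
  differential. A point p of D whose image leaves D lies, together with the image, in the open
  square |x|, |y| < pi/2, and the image has crossed the diagonal x = y. Hence the degree drops by
  exactly one. On this square all but one of the inequalities defining each component of the pairs
  \<open>\<xi>\<close> at the two boundary corners hold or fail automatically. A superlevel pair and
  a sublevel pair remain, and these can be compared with the rectangles of h(f) and h(g). Every
  comparison of covers keeps the first member first, so the sign convention of the differential
  never has to be evaluated. In a round trip at most one factor changes the degree, because
  \<open>strip_T_inv\<close> moves the square off itself.\<close>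

section \<open>The translation T and the tiles of the strip\<close>

lemma strip_T_simps [simp]: "fst (strip_T u) = - pi - snd u" "snd (strip_T u) = pi - fst u"
  by (simp_all add: strip_T_def)

lemma strip_T_inv_simps [simp]:
  "fst (strip_T_inv u) = pi - snd u" "snd (strip_T_inv u) = - pi - fst u"
  by (simp_all add: strip_T_inv_def)

lemma strip_T_inverse [simp]: "strip_T_inv (strip_T u) = u" "strip_T (strip_T_inv u) = u"
  by (simp_all add: prod_eq_iff)

lemma strip_iff: "u \<in> strip \<longleftrightarrow> - pi \<le> fst u + snd u \<and> fst u + snd u \<le> pi"
  by (auto simp: strip_def)

lemma fund_D_iff: "u \<in> fund_D \<longleftrightarrow> u \<in> strip \<and> 0 \<le> fst u - snd u \<and> fst u - snd u < 2 * pi"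
  by (auto simp: fund_D_def)

lemma strip_le_refl [simp]: "u \<preceq> u"
  by (simp add: strip_le_def)

lemma strip_le_trans: "u \<preceq> v \<Longrightarrow> v \<preceq> w \<Longrightarrow> u \<preceq> w"
  by (auto simp: strip_le_def)

lemma strip_T_in_strip [simp]: "strip_T u \<in> strip \<longleftrightarrow> u \<in> strip"
  by (auto simp: strip_iff)

lemma strip_T_inv_in_strip [simp]: "strip_T_inv u \<in> strip \<longleftrightarrow> u \<in> strip"
  by (auto simp: strip_iff)

lemma strip_T_le_iff [simp]: "strip_T u \<preceq> strip_T v \<longleftrightarrow> u \<preceq> v"
  by (auto simp: strip_le_def)

lemma strip_T_pow_0 [simp]: "strip_T_pow 0 u = u"
  by (simp add: strip_T_pow_def)

lemma strip_T_pow_Suc: "strip_T_pow (n + 1) u = strip_T (strip_T_pow n u)"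
proof (cases "0 \<le> n")
  case True
  then have "nat (n + 1) = Suc (nat n)"
    by simp
  with True show ?thesis
    by (simp add: strip_T_pow_def del: Suc_nat_eq_nat_zadd1)
next
  case False
  define m where "m = nat (- (n + 1))"
  have n: "n = - int m - 1"
    using False by (simp add: m_def)
  have "nat (- n) = Suc m" using n by simp
  moreover have "strip_T_pow (n + 1) u = (strip_T_inv ^^ m) u"
    using n by (cases "m = 0") (simp_all add: strip_T_pow_def)
  ultimately show ?thesis
    using False by (simp add: strip_T_pow_def)
qed

lemma strip_T_pow_pred: "strip_T_pow (n - 1) u = strip_T_inv (strip_T_pow n u)"
  using strip_T_pow_Suc[of "n - 1" u] by simp

lemma strip_T_pow_induct [case_names zero succ pred]:
  assumes "P (0 :: int)" and "\<And>n. P n \<Longrightarrow> P (n + 1)" and "\<And>n. P n \<Longrightarrow> P (n - 1)"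
  shows "P n"
  using int_induct[of P 0 n] assms by blast

text \<open>x - y is the coordinate along the strip, and each T lowers it by 2 pi. This makes
  \<open>tile\<close> a floor function, which in particular settles the uniqueness behind its
  \<open>THE\<close>.\<close>

lemma strip_T_pow_diff:
  "fst (strip_T_pow n u) - snd (strip_T_pow n u) = fst u - snd u - 2 * pi * of_int n"
  by (induction n rule: strip_T_pow_induct)
     (simp_all add: strip_T_pow_Suc strip_T_pow_pred algebra_simps)

lemma strip_T_pow_in_strip [simp]: "strip_T_pow n u \<in> strip \<longleftrightarrow> u \<in> strip"
  by (induction n rule: strip_T_pow_induct) (simp_all add: strip_T_pow_Suc strip_T_pow_pred)

lemma strip_T_inv_le_iff [simp]: "strip_T_inv u \<preceq> strip_T_inv v \<longleftrightarrow> u \<preceq> v"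
  by (auto simp: strip_le_def)

lemma strip_T_pow_le_iff [simp]: "strip_T_pow n u \<preceq> strip_T_pow n v \<longleftrightarrow> u \<preceq> v"
  by (induction n rule: strip_T_pow_induct) (simp_all add: strip_T_pow_Suc strip_T_pow_pred)

lemma strip_T_pow_T: "strip_T_pow n (strip_T u) = strip_T (strip_T_pow n u)"
  by (induction n rule: strip_T_pow_induct) (simp_all add: strip_T_pow_Suc strip_T_pow_pred)

lemma strip_T_pow_in_fund_D_iff:
  assumes "u \<in> strip"
  shows "strip_T_pow n u \<in> fund_D \<longleftrightarrow> n = \<lfloor>(fst u - snd u) / (2 * pi)\<rfloor>"
proof -
  have "strip_T_pow n u \<in> fund_D \<longleftrightarrow>
      of_int n * (2 * pi) \<le> fst u - snd u \<and> fst u - snd u < (of_int n + 1) * (2 * pi)"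
    using assms by (auto simp: fund_D_iff strip_T_pow_diff algebra_simps)
  also have "\<dots> \<longleftrightarrow> \<lfloor>(fst u - snd u) / (2 * pi)\<rfloor> = n"
    by (simp add: floor_eq_iff pos_le_divide_eq pos_divide_less_eq algebra_simps)
  finally show ?thesis
    by auto
qed

lemma tile_eq: "u \<in> strip \<Longrightarrow> tile u = \<lfloor>(fst u - snd u) / (2 * pi)\<rfloor>"
  unfolding tile_def by (simp add: strip_T_pow_in_fund_D_iff)

lemma tile_eq_iff: "u \<in> strip \<Longrightarrow> tile u = n \<longleftrightarrow> strip_T_pow n u \<in> fund_D"
  by (auto simp: tile_eq strip_T_pow_in_fund_D_iff)

lemma tile_antimono: "u \<in> strip \<Longrightarrow> v \<in> strip \<Longrightarrow> u \<preceq> v \<Longrightarrow> tile v \<le> tile u"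
  by (simp add: tile_eq strip_le_def floor_mono divide_right_mono)

lemma tile_T: "u \<in> strip \<Longrightarrow> tile (strip_T u) = tile u - 1"
  by (simp add: tile_eq_iff strip_T_pow_pred strip_T_pow_T) (metis tile_eq_iff)

text \<open>Together with \<open>tile_antimono\<close> this leaves only two possible tiles for v in
  the interval from u to T(u), so an internal map that can be nonzero raises the degree by at most
  one.\<close>

lemma tile_ge_if_le_T:
  "u \<in> strip \<Longrightarrow> v \<in> strip \<Longrightarrow> v \<preceq> strip_T u \<Longrightarrow> tile u - 1 \<le> tile v"
  using tile_antimono[of v "strip_T u"] by (simp add: tile_T)

section \<open>The automorphisms of the strip\<close>

text \<open>In the coordinate tan, \<open>g_tilde a\<close> is a translation on each interval of
  length pi between consecutive fixed points. The two kinds of interval alternate, so the parity of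
  j selects the amount.\<close>

definition shift_amount :: "real \<times> real \<Rightarrow> int \<Rightarrow> real" where
  "shift_amount a j = (if even j then snd a else - fst a)"

lemma tan_add_int_pi: "tan (\<theta> + of_int j * pi) = tan \<theta>"
  using tan_periodic_int[of \<theta> j] by simp

lemma branch_cases:
  obtains (fixed) j :: int where "\<theta> = of_int j * pi - pi / 2"
  | (branch) j :: int where "- pi / 2 < \<theta> - of_int j * pi" "\<theta> - of_int j * pi < pi / 2"
proof -
  define j where "j = \<lfloor>(\<theta> + pi / 2) / pi\<rfloor>"
  have "of_int j \<le> (\<theta> + pi / 2) / pi" "(\<theta> + pi / 2) / pi < of_int j + 1"
    unfolding j_def by linarith+
  then have "of_int j * pi \<le> \<theta> + pi / 2" "\<theta> + pi / 2 < (of_int j + 1) * pi"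
    by (simp_all add: pos_le_divide_eq pos_divide_less_eq)
  then consider "\<theta> = of_int j * pi - pi / 2"
    | "- pi / 2 < \<theta> - of_int j * pi" "\<theta> - of_int j * pi < pi / 2"
    unfolding distrib_right by linarith
  then show thesis
    using that by cases
qed

lemma g_tilde_branch:
  assumes "- pi / 2 < \<theta> - of_int j * pi" and "\<theta> - of_int j * pi < pi / 2"
  shows "g_tilde a \<theta> = of_int j * pi + arctan (tan \<theta> + shift_amount a j)"
proof -
  \<comment> \<open>Two consecutive branches make up one period, so \<open>k\<close> is the number
    of full periods used in \<open>g_tilde\<close> and \<open>j mod 2\<close> tells which half of
    the period contains the angle.\<close>
  define k where "k = j div 2"
  have "j = 2 * k + j mod 2"
    by (simp add: k_def)
  then have j: "of_int j = 2 * of_int k + (of_int (j mod 2) :: real)"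
    by (metis of_int_add of_int_mult of_int_numeral)
  have m: "of_int (j mod 2) = (0::real) \<and> even j \<or> of_int (j mod 2) = (1::real) \<and> odd j"
    by (auto simp: odd_iff_mod_2_eq_one)
  define r where "r = \<theta> - 2 * pi * of_int k"
  have "\<lfloor>(\<theta> + pi / 2) / (2 * pi)\<rfloor> = k"
  proof (rule floor_unique)
    have "of_int k * (2 * pi) \<le> \<theta> + pi / 2" "\<theta> + pi / 2 < (of_int k + 1) * (2 * pi)"
      using assms m by (auto simp: j algebra_simps)
    then show "of_int k \<le> (\<theta> + pi / 2) / (2 * pi)" "(\<theta> + pi / 2) / (2 * pi) < of_int k + 1"
      by (simp_all only: pos_le_divide_eq pos_divide_less_eq pi_gt_zero mult_pos_pos zero_less_numeral)
  qed
  then have g: "g_tilde a \<theta> = (if r = - pi / 2 \<or> r = pi / 2 then \<theta>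
     else if r < pi / 2 then arctan (tan r + snd a) + 2 * pi * of_int k
     else pi + arctan (tan r - fst a) + 2 * pi * of_int k)"
    by (simp add: g_tilde_def r_def Let_def)
  have t: "tan r = tan \<theta>"
    using tan_add_int_pi[of r "2 * k"] by (simp add: r_def algebra_simps)
  from m show ?thesis
  proof
    assume "of_int (j mod 2) = (0::real) \<and> even j"
    moreover from this have "- pi / 2 < r" "r < pi / 2"
      using assms by (auto simp: r_def j algebra_simps)
    ultimately show ?thesis
      by (simp add: g t shift_amount_def j)
  next
    assume "of_int (j mod 2) = (1::real) \<and> odd j"
    moreover from this have "pi / 2 < r"
      using assms by (auto simp: r_def j algebra_simps)
    moreover from this have "r \<noteq> - pi / 2"
      using pi_gt_zero by linarith
    ultimately show ?thesis
      by (simp add: g t shift_amount_def j algebra_simps)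
  qed
qed

lemma g_tilde_fixed [simp]: "g_tilde a (of_int j * pi - pi / 2) = of_int j * pi - pi / 2"
proof -
  define k where "k = j div 2"
  have "j = 2 * k + j mod 2"
    by (simp add: k_def)
  then have j: "of_int j = 2 * of_int k + (of_int (j mod 2) :: real)"
    by (metis of_int_add of_int_mult of_int_numeral)
  have m: "of_int (j mod 2) = (0::real) \<or> of_int (j mod 2) = (1::real)"
    by auto
  have "\<lfloor>(of_int j * pi - pi / 2 + pi / 2) / (2 * pi)\<rfloor> = k"
  proof (rule floor_unique)
    show "of_int k \<le> (of_int j * pi - pi / 2 + pi / 2) / (2 * pi)" 
       "(of_int j * pi - pi / 2 + pi / 2) / (2 * pi) < of_int k + 1"
      using m by (auto simp: j field_simps)
  qed
  then have "g_tilde a (of_int j * pi - pi / 2) = (let r = of_int (j mod 2) * pi - pi / 2 in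
     if r = - pi / 2 \<or> r = pi / 2 then of_int j * pi - pi / 2
     else if r < pi / 2 then arctan (tan r + snd a) + 2 * pi * of_int k
     else pi + arctan (tan r - fst a) + 2 * pi * of_int k)"
    by (simp add: g_tilde_def Let_def j algebra_simps)
  with m show ?thesis
    by (auto simp: Let_def)
qed

lemma g_tilde_branch_bounds:
  assumes "- pi / 2 < \<theta> - of_int j * pi" and "\<theta> - of_int j * pi < pi / 2"
  shows "- pi / 2 < g_tilde a \<theta> - of_int j * pi" and "g_tilde a \<theta> - of_int j * pi < pi / 2"
  using arctan_bounded[of "tan \<theta> + shift_amount a j"]
  by (simp_all add: g_tilde_branch[OF assms])

lemma shift_amount_add: "shift_amount (a + b) j = shift_amount a j + shift_amount b j"
  by (simp add: shift_amount_def)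

text \<open>Each branch is mapped to itself, and translations in the coordinate tan add up there.
  This is the homomorphism property of \<open>alpha\<close> in one coordinate.\<close>

lemma g_tilde_add: "g_tilde a (g_tilde b \<theta>) = g_tilde (a + b) \<theta>"
proof (cases \<theta> rule: branch_cases)
  case (branch j)
  have "tan (g_tilde b \<theta>) = tan \<theta> + shift_amount b j"
    using tan_add_int_pi[of "arctan (tan \<theta> + shift_amount b j)" j]
    by (simp add: g_tilde_branch[OF branch] tan_arctan add.commute)
  then show ?thesis
    by (simp add: g_tilde_branch[OF g_tilde_branch_bounds[OF branch]]
        g_tilde_branch[OF branch, of "a + b"] shift_amount_add ac_simps)
qed simp

lemma arctan_tan_branch:
  assumes "- pi / 2 < \<theta> - of_int j * pi" and "\<theta> - of_int j * pi < pi / 2"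
  shows "arctan (tan \<theta>) = \<theta> - of_int j * pi"
  using arctan_tan[of "\<theta> - of_int j * pi"] assms tan_add_int_pi[of "\<theta> - of_int j * pi" j] by simp

lemma g_tilde_0 [simp]: "g_tilde (0, 0) \<theta> = \<theta>"
proof (cases \<theta> rule: branch_cases)
  case (branch j)
  then show ?thesis
    by (simp add: g_tilde_branch[OF branch] shift_amount_def arctan_tan_branch)
qed simp

lemma g_tilde_le_fixed: "\<theta> \<le> of_int j * pi - pi / 2 \<Longrightarrow> g_tilde a \<theta> \<le> of_int j * pi - pi / 2"
proof (cases \<theta> rule: branch_cases)
  case (branch i)
  assume "\<theta> \<le> of_int j * pi - pi / 2"
  with branch have "of_int i * pi < of_int j * pi" by argo
  then have "i + 1 \<le> j" by simp
  then have "(of_int i + 1) * pi \<le> of_int j * pi"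
    by (metis mult_right_mono of_int_1 of_int_add of_int_le_iff pi_ge_zero)
  with g_tilde_branch_bounds[OF branch, of a] show ?thesis
    by (simp add: algebra_simps)
qed simp

lemma g_tilde_ge_fixed: "of_int j * pi - pi / 2 \<le> \<theta> \<Longrightarrow> of_int j * pi - pi / 2 \<le> g_tilde a \<theta>"
proof (cases \<theta> rule: branch_cases)
  case (branch i)
  assume "of_int j * pi - pi / 2 \<le> \<theta>"
  with branch have "of_int j * pi < (of_int i + 1) * pi" by (simp add: algebra_simps)
  then have "real_of_int j < of_int (i + 1)"
    by (metis mult_less_cancel_right_pos of_int_1 of_int_add pi_gt_zero)
  then have "j \<le> i" by linarith
  then have "of_int j * pi \<le> of_int i * pi"
    by (simp add: mult_right_mono)
  with g_tilde_branch_bounds[OF branch, of a] show ?thesis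
    by linarith
qed simp

text \<open>Inside one branch the map is conjugate to a translation. Angles in different branches
  are separated by a fixed point, which neither of them can cross.\<close>

lemma g_tilde_mono:
  assumes "\<theta> \<le> \<theta>'"
  shows "g_tilde a \<theta> \<le> g_tilde a \<theta>'"
proof (cases \<theta> rule: branch_cases)
  case (fixed j)
  then show ?thesis
    using g_tilde_ge_fixed[of j \<theta>' a] assms by simp
next
  case (branch j)
  show ?thesis
  proof (cases "\<theta>' < of_int (j + 1) * pi - pi / 2")
    case True
    then have b: "- pi / 2 < \<theta>' - of_int j * pi" "\<theta>' - of_int j * pi < pi / 2"
      using branch assms by (auto simp: algebra_simps)
    have "arctan (tan \<theta>) \<le> arctan (tan \<theta>')"
      by (simp only: arctan_tan_branch[OF branch] arctan_tan_branch[OF b]) (use assms in simp)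
    then show ?thesis
      by (simp add: g_tilde_branch[OF branch] g_tilde_branch[OF b] arctan_le_iff)
  next
    case False
    then show ?thesis
      using g_tilde_ge_fixed[of "j + 1" \<theta>' a] g_tilde_branch_bounds[OF branch, of a]
      by (simp add: algebra_simps)
  qed
qed

lemma g_tilde_inverse [simp]:
  "g_tilde (- fst a, - snd a) (g_tilde a \<theta>) = \<theta>" "g_tilde a (g_tilde (- fst a, - snd a) \<theta>) = \<theta>"
  using g_tilde_0 by (simp_all add: g_tilde_add plus_prod_def)

lemma g_tilde_le_iff [simp]: "g_tilde a \<theta> \<le> g_tilde a \<theta>' \<longleftrightarrow> \<theta> \<le> \<theta>'"
  using g_tilde_mono[of \<theta> \<theta>' a] g_tilde_mono[of "g_tilde a \<theta>" "g_tilde a \<theta>'" "(- fst a, - snd a)"]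
  by auto

lemma g_tilde_less_iff [simp]: "g_tilde a \<theta> < g_tilde a \<theta>' \<longleftrightarrow> \<theta> < \<theta>'"
  using g_tilde_le_iff[of a \<theta>' \<theta>] by (simp del: g_tilde_le_iff add: not_le[symmetric])

lemma g_tilde_periodic: "g_tilde a (\<theta> + 2 * pi) = g_tilde a \<theta> + 2 * pi"
proof (cases \<theta> rule: branch_cases)
  case (fixed j)
  have "of_int (j + 2) * pi - pi / 2 = \<theta> + 2 * pi"
    by (simp add: fixed algebra_simps)
  then show ?thesis
    using g_tilde_fixed[of a "j + 2"] g_tilde_fixed[of a j] fixed by metis
next
  case (branch j)
  then have "- pi / 2 < \<theta> + 2 * pi - of_int (j + 2) * pi" "\<theta> + 2 * pi - of_int (j + 2) * pi < pi / 2"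
    by (simp_all add: algebra_simps)
  from g_tilde_branch[OF this, of a] show ?thesis
    using tan_add_int_pi[of \<theta> 2]
    by (simp add: g_tilde_branch[OF branch] shift_amount_def algebra_simps)
qed

lemma g_tilde_mono_shift:
  assumes "b \<preceq> a"
  shows "g_tilde b \<theta> \<le> g_tilde a \<theta>"
proof (cases \<theta> rule: branch_cases)
  case (branch j)
  then show ?thesis
    using assms by (simp add: g_tilde_branch arctan_le_iff shift_amount_def strip_le_def)
qed simp

text \<open>Both bounds are vacuous or trivial unless the threshold lies in the branch
  \<open>(- \<pi>/2, \<pi>/2)\<close>, respectively \<open>(\<pi>/2, 3\<pi>/2)\<close>.\<close>

lemma arctan_less_g_tilde:
  assumes "arctan t < z" and "s - t \<le> snd a"
  shows "arctan s < g_tilde a z"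
proof (cases "z < pi / 2")
  case True
  with assms(1) arctan_bounded[of t]
  have b: "- pi / 2 < z - of_int 0 * pi" "z - of_int 0 * pi < pi / 2"
    by simp_all
  have "arctan t < arctan (tan z)"
    using b assms(1) by (simp add: arctan_tan)
  then have "t < tan z"
    by (simp add: arctan_less_iff)
  then show ?thesis
    using assms(2) by (simp add: g_tilde_branch[OF b] shift_amount_def arctan_less_iff)
next
  case False
  then show ?thesis
    using g_tilde_ge_fixed[of 1 z a] arctan_bounded[of s] by simp
qed

lemma g_tilde_less_arctan:
  assumes "pi - z < arctan t" and "fst a \<le> s - t"
  shows "pi - g_tilde a z < arctan s"
proof (cases "z < 3 * pi / 2")
  case True
  with assms(1) arctan_bounded[of t]
  have b: "- pi / 2 < z - of_int 1 * pi" "z - of_int 1 * pi < pi / 2"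
    by simp_all
  have "arctan (tan (pi - z)) < arctan t"
    using b assms(1) arctan_tan[of "pi - z"] by simp
  moreover have "tan (pi - z) = - tan z"
    using tan_add_int_pi[of "- z" 1] by (simp add: add.commute)
  ultimately have "- tan z < t"
    by (simp add: arctan_less_iff)
  then have "arctan (- (tan z - fst a)) < arctan s"
    using assms(2) by (simp add: arctan_less_iff)
  then show ?thesis
    by (simp add: g_tilde_branch[OF b] shift_amount_def arctan_minus del: minus_diff_eq)
next
  case False
  then show ?thesis
    using g_tilde_ge_fixed[of 2 z a] arctan_bounded[of s] by simp
qed

section \<open>The action of \<open>alpha\<close> on the strip and on the fundamental domain\<close>

lemma alpha_simps [simp]:
  "fst (alpha a u) = pi - g_tilde a (pi - fst u)" "snd (alpha a u) = g_tilde a (snd u)"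
  by (simp_all add: alpha_def)

lemma alpha_add: "alpha a (alpha b u) = alpha (a + b) u"
  by (simp add: prod_eq_iff g_tilde_add)

lemma alpha_0 [simp]: "alpha (0, 0) u = u"
  by (simp add: prod_eq_iff)

lemma alpha_le_iff [simp]: "alpha a u \<preceq> alpha a v \<longleftrightarrow> u \<preceq> v"
  by (auto simp: strip_le_def)

text \<open>Membership in the strip reads y \<le> pi - x \<le> y + 2 pi, and \<open>g_tilde\<close>
  is applied to y and to pi - x; monotonicity and periodicity preserve both inequalities.\<close>

lemma alpha_in_strip: "u \<in> strip \<Longrightarrow> alpha a u \<in> strip"
proof -
  assume u: "u \<in> strip"
  then have "snd u \<le> pi - fst u" "pi - fst u \<le> snd u + 2 * pi"
    by (auto simp: strip_iff)
  then have "g_tilde a (snd u) \<le> g_tilde a (pi - fst u)"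
    "g_tilde a (pi - fst u) \<le> g_tilde a (snd u + 2 * pi)"
    by (simp_all only: g_tilde_le_iff)
  then show ?thesis
    by (simp add: strip_iff g_tilde_periodic)
qed

lemma alpha_T: "alpha a (strip_T u) = strip_T (alpha a u)"
  using g_tilde_periodic[of a "snd u"] by (simp add: prod_eq_iff add.commute)

lemma alpha_T_inv: "alpha a (strip_T_inv u) = strip_T_inv (alpha a u)"
  using alpha_T[of a "strip_T_inv u"] strip_T_inverse by metis

lemma alpha_T_pow: "alpha a (strip_T_pow n u) = strip_T_pow n (alpha a u)"
  by (induction n rule: strip_T_pow_induct)
     (simp_all add: strip_T_pow_Suc strip_T_pow_pred alpha_T alpha_T_inv)

lemma alpha_mono_shift: "b \<preceq> a \<Longrightarrow> alpha b u \<preceq> alpha a u"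
  by (simp add: strip_le_def[of "alpha _ _"] g_tilde_mono_shift)

text \<open>Turns the condition that p lies in E, as used in \<open>vec_h\<close>, into the
  condition that \<open>alpha a p\<close> still lies in D.\<close>

lemma alpha_image_iff: "u \<in> alpha (- fst a, - snd a) ` A \<longleftrightarrow> alpha a u \<in> A"
proof -
  have "alpha (- fst a, - snd a) (alpha a u) = u" "\<And>v. alpha a (alpha (- fst a, - snd a) v) = v"
    using alpha_0 by (simp_all add: alpha_add plus_prod_def)
  then show ?thesis
    by (auto intro: image_eqI[of _ _ "alpha a u"])
qed

text \<open>The diagonal point (c, c) of the open square goes to (arctan (tan c + a1), arctan (tan c
  + a2)) with a = (a1, a2), so a1 \<le> a2 never pushes it below the diagonal.\<close>

lemma alpha_diag:
  assumes "fst a \<le> snd a" and "- pi / 2 < c" and "c < pi / 2"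
  shows "pi - g_tilde a (pi - c) \<le> g_tilde a c"
proof -
  have t: "tan (pi - c) = - tan c"
    using tan_add_int_pi[of "- c" 1] by (simp add: add.commute)
  have b0: "- pi / 2 < c - of_int 0 * pi" "c - of_int 0 * pi < pi / 2"
    and b1: "- pi / 2 < pi - c - of_int 1 * pi" "pi - c - of_int 1 * pi < pi / 2"
    using assms by simp_all
  have "arctan (- (- tan c - fst a)) \<le> arctan (tan c + snd a)"
    using assms(1) by (simp add: arctan_le_iff)
  then show ?thesis
    by (simp add: g_tilde_branch[OF b0] g_tilde_branch[OF b1] shift_amount_def
        t arctan_minus del: minus_diff_eq)
qed

lemma alpha_upper:
  assumes "fst a \<le> snd a" and "u \<in> strip" and "fst u < snd u"
  shows "fst (alpha a u) < snd (alpha a u)"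
proof -
  have "fst u < pi / 2" "- pi / 2 < snd u"
    using assms(2,3) by (auto simp: strip_iff)
  \<comment> \<open>The midpoint of the part of the interval from \<open>fst u\<close> to
    \<open>snd u\<close> inside (-pi/2, pi/2): the point (c, c) lies on the diagonal segment of the
    open square, strictly below u in the order.\<close>
  define c where "c = (max (fst u) (- pi / 2) + min (snd u) (pi / 2)) / 2"
  have c: "- pi / 2 < c" "c < pi / 2" "fst u < c" "c < snd u"
    using assms(3) \<open>fst u < pi / 2\<close> \<open>- pi / 2 < snd u\<close> pi_gt_zero
    by (auto simp: c_def max_def min_def)
  have "pi - g_tilde a (pi - fst u) < pi - g_tilde a (pi - c)"
    using c by simp
  also have "\<dots> \<le> g_tilde a c"
    using alpha_diag[OF assms(1) c(1,2)] .
  also have "\<dots> < g_tilde a (snd u)"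
    using c by simp
  finally show ?thesis
    by simp
qed

text \<open>This is the inclusion \<open>D \<subseteq> E \<union> T(E)\<close>: a point leaving \<open>D\<close> lies in the open square.\<close>

lemma alpha_leaves_fund_D:
  assumes "fst a \<le> snd a" and u: "u \<in> fund_D" and "alpha a u \<notin> fund_D"
  shows "fst (alpha a u) < snd (alpha a u)"
    and "strip_T_inv (alpha a u) \<in> fund_D"
    and "fst u < pi / 2" and "- pi / 2 < fst u" and "snd u < pi / 2" and "- pi / 2 < snd u"
    and "fst (alpha a u) < pi / 2" and "- pi / 2 < fst (alpha a u)"
    and "snd (alpha a u) < pi / 2" and "- pi / 2 < snd (alpha a u)"
proof -
  have us: "u \<in> strip" "0 \<le> fst u - snd u" "fst u - snd u < 2 * pi"
    using u by (auto simp: fund_D_iff)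
  have w: "alpha a u \<in> strip"
    using us(1) by (rule alpha_in_strip)
  \<comment> \<open>The upper bound x - y < 2 pi says that T(u) is strictly above the diagonal.
    Since \<open>alpha a\<close> keeps it there, the image of u can leave D only through the
    diagonal.\<close>
  have "fst (strip_T u) < snd (strip_T u)"
    using us by simp
  then have "fst (alpha a (strip_T u)) < snd (alpha a (strip_T u))"
    using alpha_upper[OF assms(1)] us(1) strip_T_in_strip by blast
  then have upper: "fst (alpha a u) - snd (alpha a u) < 2 * pi"
    unfolding alpha_T strip_T_simps by linarith
  then show less: "fst (alpha a u) < snd (alpha a u)"
    using assms(3) w by (auto simp: fund_D_iff)
  have fu: "- pi / 2 \<le> fst u" and su: "snd u \<le> pi / 2"
    using us by (auto simp: strip_iff)
  have fw: "fst (alpha a u) < pi / 2" and sw: "- pi / 2 < snd (alpha a u)"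
    using less w unfolding strip_iff by linarith+
  have fix1: "g_tilde a (pi / 2) = pi / 2" and fix0: "g_tilde a (- pi / 2) = - pi / 2"
    and fix2: "g_tilde a (3 * pi / 2) = 3 * pi / 2"
    using g_tilde_fixed[of a 1] g_tilde_fixed[of a 0] g_tilde_fixed[of a 2] by simp_all
  \<comment> \<open>Bounds on the image by a multiple of pi/2 are bounds by a value of
    \<open>g_tilde\<close> at a fixed point, so \<open>g_tilde\<close> cancels and the bound passes
    to u. Further down the same argument runs from u to its image.\<close>
  have "g_tilde a (pi / 2) < g_tilde a (pi - fst u)"
    using fw unfolding fix1 by simp
  then show fu2: "fst u < pi / 2"
    unfolding g_tilde_less_iff by linarith
  have "g_tilde a (- pi / 2) < g_tilde a (snd u)"
    using sw unfolding fix0 by simp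
  then show su2: "- pi / 2 < snd u"
    unfolding g_tilde_less_iff by linarith
  show fu3: "- pi / 2 < fst u" and su3: "snd u < pi / 2"
    using su2 fu2 us(2) by linarith+
  have "g_tilde a (pi - fst u) < g_tilde a (3 * pi / 2)" "g_tilde a (snd u) < g_tilde a (pi / 2)"
    using fu3 su3 unfolding g_tilde_less_iff by linarith+
  then show fw2: "- pi / 2 < fst (alpha a u)" and sw2: "snd (alpha a u) < pi / 2"
    unfolding fix1 fix2 by simp_all
  show "strip_T_inv (alpha a u) \<in> fund_D"
    using less fw fw2 sw sw2 w unfolding fund_D_iff strip_T_inv_simps strip_T_inv_in_strip
    by linarith
  show "fst (alpha a u) < pi / 2" "- pi / 2 < snd (alpha a u)"
    by (rule fw, rule sw)
qed

lemma alpha_square: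
  "pi / 2 \<le> fst u \<Longrightarrow> pi / 2 \<le> fst (alpha a u)" "- pi / 2 \<le> fst u \<Longrightarrow> - pi / 2 \<le> fst (alpha a u)"
  "snd u \<le> pi / 2 \<Longrightarrow> snd (alpha a u) \<le> pi / 2" "snd u \<le> - pi / 2 \<Longrightarrow> snd (alpha a u) \<le> - pi / 2"
  using g_tilde_le_fixed[of "pi - fst u" 1 a] g_tilde_le_fixed[of "pi - fst u" 2 a]
    g_tilde_le_fixed[of "snd u" 1 a] g_tilde_le_fixed[of "snd u" 0 a]
  by simp_all

lemma strip_T_inv_alpha_le_iff: "strip_T_inv (alpha a u) \<preceq> alpha a v \<longleftrightarrow> strip_T_inv u \<preceq> v"
  using alpha_le_iff[of a "strip_T_inv u" v] by (simp only: alpha_T_inv)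

lemma strip_T_alpha_le_iff: "alpha a u \<preceq> strip_T (alpha a v) \<longleftrightarrow> u \<preceq> strip_T v"
  using alpha_le_iff[of a u "strip_T v"] by (simp only: alpha_T)

lemma strip_T_inv_le_iff': "strip_T_inv u \<preceq> v \<longleftrightarrow> u \<preceq> strip_T v"
  by (metis strip_T_le_iff strip_T_inverse(2))

lemma rep_alpha_same:
  assumes "u \<in> strip" and "tile (alpha a u) = tile u"
  shows "strip_T_pow (tile (alpha a u)) (alpha a u) = alpha a (strip_T_pow (tile u) u)"
    and "alpha a (strip_T_pow (tile u) u) \<in> fund_D"
  using assms tile_eq_iff[OF alpha_in_strip[OF assms(1)], of a "tile u"]
  by (simp_all add: alpha_T_pow)

text \<open>As \<open>alpha\<close> commutes with T, a change of tile can be read off the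
  representative in D: its image leaves D, and one application of \<open>strip_T_inv\<close> brings
  it back.\<close>

lemma rep_alpha_shift:
  assumes "fst a \<le> snd a" and "u \<in> strip" and "tile (alpha a u) \<noteq> tile u"
  shows "tile (alpha a u) = tile u - 1"
    and "strip_T_pow (tile (alpha a u)) (alpha a u) = strip_T_inv (alpha a (strip_T_pow (tile u) u))"
    and "alpha a (strip_T_pow (tile u) u) \<notin> fund_D"
    and "strip_T_inv (alpha a (strip_T_pow (tile u) u)) \<in> fund_D"
proof -
  note t = tile_eq_iff[OF alpha_in_strip[OF assms(2)], of a]
  show notin: "alpha a (strip_T_pow (tile u) u) \<notin> fund_D"
    using assms(3) t[of "tile u"] by (simp add: alpha_T_pow)
  have "strip_T_pow (tile u) u \<in> fund_D"
    using tile_eq_iff[OF assms(2)] by blast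
  from alpha_leaves_fund_D(2)[OF assms(1) this notin]
  show q: "strip_T_inv (alpha a (strip_T_pow (tile u) u)) \<in> fund_D" .
  then have "strip_T_pow (tile u - 1) (alpha a u) \<in> fund_D"
    by (simp only: strip_T_pow_pred alpha_T_pow)
  then show eq: "tile (alpha a u) = tile u - 1"
    using t by blast
  show "strip_T_pow (tile (alpha a u)) (alpha a u) = strip_T_inv (alpha a (strip_T_pow (tile u) u))"
    by (simp only: eq strip_T_pow_pred alpha_T_pow)
qed

text \<open>The resulting normal form has \<open>strip_T_inv\<close> outermost, then
  \<open>alpha\<close>, then the power of T; the lemmas about points of D are stated in this
  form.\<close>

lemmas strip_T_pow_normalize = strip_T_pow_pred alpha_T_inv alpha_T_pow[symmetric]

section \<open>Linear maps and transformations\<close>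

lemma linear_map_in_carrier:
  "linear_map K V W \<phi> \<Longrightarrow> z \<in> carrier V \<Longrightarrow> \<phi> z \<in> carrier W"
  by (auto simp: linear_map_def)

lemma linear_map_zero:
  assumes "linear_map K V W \<phi>" and "Module.module K V" and "Module.module K W"
  shows "\<phi> \<zero>\<^bsub>V\<^esub> = \<zero>\<^bsub>W\<^esub>"
proof -
  interpret V: module K V by fact
  interpret W: module K W by fact
  have c: "\<phi> \<zero>\<^bsub>V\<^esub> \<in> carrier W"
    using assms(1) by (rule linear_map_in_carrier) simp
  have "\<phi> (\<zero>\<^bsub>V\<^esub> \<oplus>\<^bsub>V\<^esub> \<zero>\<^bsub>V\<^esub>) = \<phi> \<zero>\<^bsub>V\<^esub> \<oplus>\<^bsub>W\<^esub> \<phi> \<zero>\<^bsub>V\<^esub>"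
    using assms(1) V.zero_closed unfolding linear_map_def by blast
  then have "\<phi> \<zero>\<^bsub>V\<^esub> \<oplus>\<^bsub>W\<^esub> \<phi> \<zero>\<^bsub>V\<^esub> = \<phi> \<zero>\<^bsub>V\<^esub>"
    by simp
  with c show ?thesis
    using W.M.add.l_cancel_one by simp
qed

lemma linear_map_comp:
  "linear_map K U V \<phi> \<Longrightarrow> linear_map K V W \<psi> \<Longrightarrow> linear_map K U W (\<psi> \<circ> \<phi>)"
  by (auto simp: linear_map_def Pi_iff)

lemma linear_map_const_zero:
  assumes "Module.module K W"
  shows "linear_map K V W (\<lambda>z. \<zero>\<^bsub>W\<^esub>)"
proof -
  interpret module K W by fact
  show ?thesis
    by (simp add: linear_map_def smult_r_null)
qed

lemma linear_map_cong:
  assumes "linear_map K V W \<phi>" and "\<And>z. z \<in> carrier V \<Longrightarrow> \<psi> z = \<phi> z" and "Module.module K V"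
  shows "linear_map K V W \<psi>"
proof -
  interpret module K V by fact
  show ?thesis
    using assms(1) by (auto simp: linear_map_def assms(2))
qed

lemma precompose_functor:
  assumes F: "is_strip_functor K F" and \<beta>: "\<And>u. u \<in> strip \<Longrightarrow> \<beta> u \<in> strip"
    and mono: "\<And>u v. u \<preceq> v \<Longrightarrow> \<beta> u \<preceq> \<beta> v"
  shows "is_strip_functor K (precompose F \<beta>)"
  unfolding is_strip_functor_def precompose_def strip_functor.select_convs
  using F[unfolded is_strip_functor_def] by (intro conjI ballI impI) (meson \<beta> mono)+

lemma nt_comp_natural:
  assumes "natural_transformation K F G \<theta>" and "natural_transformation K G H \<eta>"
  shows "natural_transformation K F H (nt_comp \<eta> \<theta>)"
proof -
  have \<theta>: "linear_map K (fobj F u) (fobj G u) (\<theta> u)" if "u \<in> strip" for u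
    using assms(1) that by (simp add: natural_transformation_def)
  show ?thesis
    using assms linear_map_in_carrier[OF \<theta>]
    unfolding natural_transformation_def nt_comp_def
    by (auto intro: linear_map_comp)
qed

text \<open>Both sides of the naturality square equal the single internal map from
  \<open>alpha a v\<close> to \<open>alpha b u\<close>.\<close>

lemma alpha_trans_natural:
  assumes F: "is_strip_functor K F" and ba: "b \<preceq> a"
  shows "natural_transformation K (precompose F (alpha a)) (precompose F (alpha b)) (alpha_trans F b a)"
  unfolding natural_transformation_def
proof (intro conjI ballI impI)
  show "is_strip_functor K (precompose F (alpha a))" "is_strip_functor K (precompose F (alpha b))"
    by (intro precompose_functor[OF F] alpha_in_strip; simp)+
next
  fix u assume u: "u \<in> strip"
  have "linear_map K (fobj F (alpha a u)) (fobj F (alpha b u)) (fmap F (alpha b u) (alpha a u))"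
    using F alpha_in_strip[OF u] alpha_mono_shift[OF ba] unfolding is_strip_functor_def by blast
  then show "linear_map K (fobj (precompose F (alpha a)) u) (fobj (precompose F (alpha b)) u) (alpha_trans F b a u)"
    by (simp add: precompose_def alpha_trans_def)
next
  fix u v z assume u: "u \<in> strip" and v: "v \<in> strip" and uv: "u \<preceq> v"
    and z: "z \<in> carrier (fobj (precompose F (alpha a)) v)"
  have comp: "fmap F p r z = fmap F p q (fmap F q r z)"
    if "p \<in> strip" "q \<in> strip" "r \<in> strip" "p \<preceq> q" "q \<preceq> r" "z \<in> carrier (fobj F r)" for p q r
    using F that unfolding is_strip_functor_def by blast
  have "fmap F (alpha b u) (alpha a v) z = fmap F (alpha b u) (alpha a u) (fmap F (alpha a u) (alpha a v) z)"
    "fmap F (alpha b u) (alpha a v) z = fmap F (alpha b u) (alpha b v) (fmap F (alpha b v) (alpha a v) z)"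
    using z by (intro comp alpha_in_strip u v alpha_mono_shift[OF ba]; simp add: uv precompose_def)+
  then show "alpha_trans F b a u (fmap (precompose F (alpha a)) u v z) =
      fmap (precompose F (alpha b)) u v (alpha_trans F b a v z)"
    by (simp add: alpha_trans_def precompose_def)
qed

section \<open>Mayer--Vietoris differentials\<close>

definition pair_le :: "'a set \<times> 'a set \<Rightarrow> 'a set \<times> 'a set \<Rightarrow> bool" where
  "pair_le P Q \<longleftrightarrow> fst P \<subseteq> fst Q \<and> snd P \<subseteq> snd Q"

lemma pair_le_refl [simp]: "pair_le P P"
  by (simp add: pair_le_def)

lemma pair_le_trans: "pair_le P Q \<Longrightarrow> pair_le Q R \<Longrightarrow> pair_le P R"
  by (auto simp: pair_le_def)

lemma open_pair_int: "open_pair Y P \<Longrightarrow> open_pair Y Q \<Longrightarrow> open_pair Y (pair_int P Q)"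
  by (auto simp: open_pair_def pair_int_def)

lemma open_pair_un: "open_pair Y P \<Longrightarrow> open_pair Y Q \<Longrightarrow> open_pair Y (pair_un P Q)"
  by (auto simp: open_pair_def pair_un_def)

lemma open_pair_empty [simp]: "open_pair Y ({}, {})"
  by (simp add: open_pair_def)

lemma is_pair_sub_pair: "open_pair Y P \<Longrightarrow> is_pair (sub_pair Y P)"
  using openin_subset by (fastforce simp: open_pair_def is_pair_def sub_pair_def)

lemma pair_map_sub_pair:
  "open_pair Y P \<Longrightarrow> open_pair Y Q \<Longrightarrow> pair_le P Q \<Longrightarrow>
   pair_map (sub_pair Y P) (sub_pair Y Q) (\<lambda>x. x)"
  by (auto simp: pair_map_def is_pair_sub_pair pair_le_def)
     (auto simp: sub_pair_def continuous_map_in_subtopology continuous_map_from_subtopology)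

locale mayer_vietoris_theory = cohomology_theory K C + relative_mayer_vietoris K C
  for K :: "('k, 'm) ring_scheme" and C :: "('a, 'k, 'v) cohomology" +
  fixes X :: "'a topology"
begin

abbreviation hcoh :: "int \<Rightarrow> 'a set \<times> 'a set \<Rightarrow> ('k, 'v) module" where
  "hcoh n P \<equiv> coh C n (sub_pair X P)"

abbreviation restr :: "int \<Rightarrow> 'a set \<times> 'a set \<Rightarrow> 'a set \<times> 'a set \<Rightarrow> 'v \<Rightarrow> 'v" where
  "restr n P Q \<equiv> coh_map C n (sub_pair X P) (sub_pair X Q) (\<lambda>x. x)"

lemma module_hcoh: "open_pair X P \<Longrightarrow> Module.module K (hcoh n P)"
  by (simp add: vector_spaces is_pair_sub_pair)

lemma restr_linear:
  "open_pair X P \<Longrightarrow> open_pair X Q \<Longrightarrow> pair_le P Q \<Longrightarrow>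
   linear_map K (hcoh n Q) (hcoh n P) (restr n P Q)"
  by (simp add: coh_map_linear pair_map_sub_pair)

lemma restr_in:
  "open_pair X P \<Longrightarrow> open_pair X Q \<Longrightarrow> pair_le P Q \<Longrightarrow> z \<in> carrier (hcoh n Q) \<Longrightarrow>
   restr n P Q z \<in> carrier (hcoh n P)"
  using restr_linear linear_map_in_carrier by metis

lemma restr_self: "open_pair X P \<Longrightarrow> z \<in> carrier (hcoh n P) \<Longrightarrow> restr n P P z = z"
  by (simp add: coh_map_id is_pair_sub_pair)

lemma restr_restr:
  assumes "open_pair X P" "open_pair X Q" "open_pair X R" "pair_le P Q" "pair_le Q R"
    and "z \<in> carrier (hcoh n R)"
  shows "restr n P Q (restr n Q R z) = restr n P R z"
  using coh_map_comp[OF pair_map_sub_pair[OF assms(1,2,4)] pair_map_sub_pair[OF assms(2,3,5)] assms(6)]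
  by (simp add: comp_def)

lemma restr_zero:
  "open_pair X P \<Longrightarrow> open_pair X Q \<Longrightarrow> pair_le P Q \<Longrightarrow>
   restr n P Q \<zero>\<^bsub>hcoh n Q\<^esub> = \<zero>\<^bsub>hcoh n P\<^esub>"
  using linear_map_zero restr_linear module_hcoh by metis

lemma mv_in:
  "open_pair X P \<Longrightarrow> open_pair X Q \<Longrightarrow> z \<in> carrier (hcoh (n - 1) (pair_int P Q)) \<Longrightarrow>
   mv_diff C n X P Q z \<in> carrier (hcoh n (pair_un P Q))"
  using mv_linear linear_map_in_carrier by metis

lemma restr_mv:
  assumes "open_pair X P" "open_pair X Q" "open_pair X P'" "open_pair X Q'"
    and "pair_le P P'" "pair_le Q Q'" and "z \<in> carrier (hcoh (n - 1) (pair_int P' Q'))"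
  shows "restr n (pair_un P Q) (pair_un P' Q') (mv_diff C n X P' Q' z) =
    mv_diff C n X P Q (restr (n - 1) (pair_int P Q) (pair_int P' Q') z)"
  by (rule mv_natural[OF assms(1-4) _ _ _ _ _ assms(7)])
     (use assms in \<open>auto simp: pair_le_def continuous_map_in_subtopology continuous_map_from_subtopology\<close>)

section \<open>Comparison and vanishing of differentials of two-member covers\<close>

definition mv_through ::
    "int \<Rightarrow> 'a set \<times> 'a set \<Rightarrow> 'a set \<times> 'a set \<Rightarrow> 'a set \<times> 'a set \<Rightarrow> 'a set \<times> 'a set \<Rightarrow> 'v \<Rightarrow> 'v" where
  "mv_through n W P Q R z =
     restr n W (pair_un P Q) (mv_diff C n X P Q (restr (n - 1) (pair_int P Q) R z))"

definition mv_cover ::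
    "'a set \<times> 'a set \<Rightarrow> 'a set \<times> 'a set \<Rightarrow> 'a set \<times> 'a set \<Rightarrow> 'a set \<times> 'a set \<Rightarrow> bool" where
  "mv_cover W P Q R \<longleftrightarrow> open_pair X W \<and> open_pair X P \<and> open_pair X Q \<and> open_pair X R \<and>
     pair_le W (pair_un P Q) \<and> pair_le (pair_int P Q) R"

lemma mv_coverD:
  assumes "mv_cover W P Q R"
  shows "open_pair X W" "open_pair X P" "open_pair X Q" "open_pair X R"
    "open_pair X (pair_un P Q)" "open_pair X (pair_int P Q)"
    "pair_le W (pair_un P Q)" "pair_le (pair_int P Q) R"
  using assms by (auto simp: mv_cover_def open_pair_un open_pair_int)

lemma mv_through_in:
  assumes "mv_cover W P Q R" and "z \<in> carrier (hcoh (n - 1) R)"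
  shows "mv_through n W P Q R z \<in> carrier (hcoh n W)"
  unfolding mv_through_def by (intro restr_in mv_in mv_coverD[OF assms(1)] assms(2))

lemma mv_diff_eq_mv_through:
  assumes "open_pair X P" "open_pair X Q" and "z \<in> carrier (hcoh (n - 1) (pair_int P Q))"
  shows "mv_diff C n X P Q z = mv_through n (pair_un P Q) P Q (pair_int P Q) z"
  using assms by (simp add: mv_through_def restr_self open_pair_int open_pair_un mv_in)

lemma restr_mv_through:
  assumes "mv_cover W P Q R" and "z \<in> carrier (hcoh (n - 1) R)"
    and "open_pair X W'" and "pair_le W' W"
  shows "restr n W' W (mv_through n W P Q R z) = mv_through n W' P Q R z"
  unfolding mv_through_def
  by (intro restr_restr assms(3,4) restr_in mv_in mv_coverD[OF assms(1)] assms(2))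

lemma mv_through_restr:
  assumes "mv_cover W P Q R" and "z \<in> carrier (hcoh (n - 1) R')"
    and "open_pair X R'" and "pair_le R R'"
  shows "mv_through n W P Q R (restr (n - 1) R R' z) = mv_through n W P Q R' z"
  unfolding mv_through_def using assms mv_coverD[OF assms(1)] by (simp add: restr_restr)

text \<open>This is the naturality square for the inclusion of the finer cover into the coarser one;
  its two vertical restrictions are absorbed into the restrictions to W and from R.\<close>

lemma mv_through_refine:
  assumes PQ: "mv_cover W P Q R" and PQ': "mv_cover W P' Q' R"
    and le: "pair_le P P'" "pair_le Q Q'" and z: "z \<in> carrier (hcoh (n - 1) R)"
  shows "mv_through n W P' Q' R z = mv_through n W P Q R z"
proof -
  note c = mv_coverD[OF PQ] and c' = mv_coverD[OF PQ']
  have un: "pair_le (pair_un P Q) (pair_un P' Q')" and int: "pair_le (pair_int P Q) (pair_int P' Q')"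
    using le by (auto simp: pair_le_def pair_un_def pair_int_def)
  define y where "y = restr (n - 1) (pair_int P' Q') R z"
  have y: "y \<in> carrier (hcoh (n - 1) (pair_int P' Q'))"
    unfolding y_def by (intro restr_in c' z)
  have "mv_through n W P' Q' R z =
      restr n W (pair_un P Q) (restr n (pair_un P Q) (pair_un P' Q') (mv_diff C n X P' Q' y))"
    using restr_restr[OF c(1,5) c'(5) c(7) un mv_in[OF c'(2,3) y]]
    by (simp add: mv_through_def y_def)
  also have "\<dots> = restr n W (pair_un P Q) (mv_diff C n X P Q (restr (n - 1) (pair_int P Q) (pair_int P' Q') y))"
    using restr_mv[OF c(2,3) c'(2,3) le y] by simp
  also have "\<dots> = mv_through n W P Q R z"
    using restr_restr[OF c(6) c'(6,4) int c'(8) z] by (simp add: mv_through_def y_def)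
  finally show ?thesis .
qed

text \<open>Both covers are compared with their memberwise intersection. Its overlap is
  automatically inside R, so only the covering of W has to be required.\<close>

lemma mv_through_eqI:
  assumes "mv_cover W P Q R" and "mv_cover W P' Q' R" and "z \<in> carrier (hcoh (n - 1) R)"
    and "pair_le W (pair_un (pair_int P P') (pair_int Q Q'))"
  shows "mv_through n W P Q R z = mv_through n W P' Q' R z"
proof -
  have "mv_cover W (pair_int P P') (pair_int Q Q') R"
    using assms unfolding mv_cover_def
    by (intro conjI open_pair_int) (auto simp: pair_le_def pair_int_def)
  from mv_through_refine[OF this assms(1) _ _ assms(3)] mv_through_refine[OF this assms(2) _ _ assms(3)]
  show ?thesis
    by (simp add: pair_le_def pair_int_def)
qed

text \<open>Dual to \<open>mv_through_eqI\<close>: both covers are compared with their memberwise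
  union. It automatically covers W, and only the cross terms of its overlap have to be required to
  lie in R.\<close>

lemma mv_through_eqI':
  assumes "mv_cover W P Q R" and "mv_cover W P' Q' R" and "z \<in> carrier (hcoh (n - 1) R)"
    and "pair_le (pair_un (pair_int P Q') (pair_int P' Q)) R"
  shows "mv_through n W P Q R z = mv_through n W P' Q' R z"
proof -
  have "mv_cover W (pair_un P P') (pair_un Q Q') R"
    using assms unfolding mv_cover_def
    by (intro conjI open_pair_un) (auto simp: pair_le_def pair_int_def pair_un_def)
  from mv_through_refine[OF assms(1) this _ _ assms(3)] mv_through_refine[OF assms(2) this _ _ assms(3)]
  show ?thesis
    by (simp add: pair_le_def pair_un_def)
qed

lemma mv_through_zero:
  assumes PQ: "mv_cover W P Q R" and z: "z \<in> carrier (hcoh (n - 1) R)"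
    and "pair_le W P \<or> pair_le W Q \<or> pair_le P R \<or> pair_le Q R"
  shows "mv_through n W P Q R z = \<zero>\<^bsub>hcoh n W\<^esub>"
proof -
  \<comment> \<open>If W lies in a member of the cover, the restriction to W passes through that
    member, where consecutive Mayer--Vietoris maps compose to zero. P and Q are arbitrary here
    because the fact is reused below for other covers.\<close>
  have W: "mv_through n W P Q R z = \<zero>\<^bsub>hcoh n W\<^esub>"
    if PQ: "mv_cover W P Q R" and W: "pair_le W P \<or> pair_le W Q" for P Q
  proof -
    note c = mv_coverD[OF PQ]
    define y where "y = restr (n - 1) (pair_int P Q) R z"
    have y: "y \<in> carrier (hcoh (n - 1) (pair_int P Q))"
      unfolding y_def by (intro restr_in c z)
    have "mv_diff C n X P Q y \<in> mv_diff C n X P Q ` carrier (hcoh (n - 1) (pair_int P Q))"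
      using y by blast
    then have 0: "restr n P (pair_un P Q) (mv_diff C n X P Q y) = \<zero>\<^bsub>hcoh n P\<^esub>"
      "restr n Q (pair_un P Q) (mv_diff C n X P Q y) = \<zero>\<^bsub>hcoh n Q\<^esub>"
      unfolding mv_exact_un[OF c(2,3), symmetric] by simp_all
    have le: "pair_le P (pair_un P Q)" "pair_le Q (pair_un P Q)"
      by (auto simp: pair_le_def pair_un_def)
    from W show ?thesis
      using restr_restr[OF c(1,2,5) _ le(1) mv_in[OF c(2,3) y]]
        restr_restr[OF c(1,3,5) _ le(2) mv_in[OF c(2,3) y]]
        restr_zero[OF c(1,2)] restr_zero[OF c(1,3)] 0
      by (fastforce simp: mv_through_def y_def)
  qed
  \<comment> \<open>Degenerate covers with W itself as a member. If R contains P or Q,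
    \<open>mv_through_eqI'\<close> replaces the given cover by one of these, and the case already
    treated applies.\<close>
  have empty: "mv_cover W ({}, {}) W R" "mv_cover W W ({}, {}) R"
    using PQ by (auto simp: mv_cover_def pair_le_def pair_un_def pair_int_def)
  consider "pair_le W P \<or> pair_le W Q" | "pair_le P R" | "pair_le Q R"
    using assms(3) by blast
  then show ?thesis
  proof cases
    case 2
    then have "mv_through n W P Q R z = mv_through n W ({}, {}) W R z"
      by (intro mv_through_eqI' PQ empty z) (auto simp: pair_le_def pair_un_def pair_int_def)
    with W[OF empty(1)] show ?thesis by simp
  next
    case 3
    then have "mv_through n W P Q R z = mv_through n W W ({}, {}) R z"
      by (intro mv_through_eqI' PQ empty z) (auto simp: pair_le_def pair_un_def pair_int_def)
    with W[OF empty(2)] show ?thesis by simp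
  qed (rule W[OF PQ])
qed

section \<open>The functor \<open>h(f)\<close>\<close>

definition level_pair :: "('a \<Rightarrow> real) \<Rightarrow> real \<times> real \<Rightarrow> 'a set \<times> 'a set" where
  "level_pair f u = preimage_pair X f (rho u)"

lemma level_pair_simps:
  "fst (level_pair f u) =
    {x \<in> topspace X. - pi - snd u < arctan (f x) \<and> arctan (f x) < pi - fst u}"
  "snd (level_pair f u) = {x \<in> topspace X. arctan (f x) < snd u \<or> fst u < arctan (f x)}"
  by (simp_all add: level_pair_def preimage_pair_def rho_def rho1_def rho0_def)

lemma openin_less_arctan:
  assumes "continuous_map X euclideanreal f"
  shows "openin X {x \<in> topspace X. c < arctan (f x)}" "openin X {x \<in> topspace X. arctan (f x) < c}"
proof -
  have "continuous_map X euclideanreal (arctan \<circ> f)"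
    by (rule continuous_map_compose[OF assms]) (simp add: continuous_on_arctan)
  from openin_continuous_map_preimage[OF this, of "{c<..}"]
    openin_continuous_map_preimage[OF this, of "{..<c}"]
  show "openin X {x \<in> topspace X. c < arctan (f x)}" "openin X {x \<in> topspace X. arctan (f x) < c}"
    by simp_all
qed

lemma open_level_pair:
  assumes "continuous_map X euclideanreal f" and "u \<in> strip"
  shows "open_pair X (level_pair f u)"
proof -
  have "fst (level_pair f u) =
      {x \<in> topspace X. - pi - snd u < arctan (f x)} \<inter> {x \<in> topspace X. arctan (f x) < pi - fst u}"
    "snd (level_pair f u) =
      {x \<in> topspace X. arctan (f x) < snd u} \<union> {x \<in> topspace X. fst u < arctan (f x)}"
    by (auto simp: level_pair_simps)
  then have "openin X (fst (level_pair f u))" "openin X (snd (level_pair f u))"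
    using openin_less_arctan[OF assms(1)] by (simp_all add: openin_Int openin_Un)
  moreover have "snd (level_pair f u) \<subseteq> fst (level_pair f u)"
  proof
    fix x assume "x \<in> snd (level_pair f u)"
    then show "x \<in> fst (level_pair f u)"
      using assms(2) arctan_bounded[of "f x"] unfolding level_pair_simps strip_iff mem_Collect_eq
      by argo
  qed
  ultimately show ?thesis
    by (simp add: open_pair_def)
qed

lemma level_pair_mono: "u \<preceq> v \<Longrightarrow> pair_le (level_pair f u) (level_pair f v)"
  by (auto simp: pair_le_def level_pair_simps strip_le_def)

text \<open>The upper left corner \<open>w\<close>, belonging to the target, comes before the lower
  right corner \<open>p\<close>. By \<open>rect_un\<close> and \<open>rect_int\<close> the two outer
  restrictions are along identities when the rectangle lies in D.\<close>

abbreviation rect_mv :: "('a \<Rightarrow> real) \<Rightarrow> int \<Rightarrow> real \<times> real \<Rightarrow> real \<times> real \<Rightarrow> 'v \<Rightarrow> 'v" where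
  "rect_mv f n w p \<equiv> mv_through n (level_pair f w)
     (level_pair f (fst w, snd p)) (level_pair f (fst p, snd w)) (level_pair f p)"

text \<open>The hypothesis on T(p) supplies the lower strip bound at the lower left corner and the
  upper one at the upper right corner. The remaining bounds are inherited from p.\<close>

lemma rect_corners_in_strip:
  assumes "w \<in> fund_D" "p \<in> fund_D" "w \<preceq> strip_T p" "p \<preceq> w"
  shows "(fst w, snd p) \<in> strip" "(fst p, snd w) \<in> strip"
  using assms by (auto simp: fund_D_iff strip_iff strip_le_def)

lemma fund_D_convex:
  "p \<in> fund_D \<Longrightarrow> w \<in> fund_D \<Longrightarrow> q \<in> strip \<Longrightarrow> p \<preceq> q \<Longrightarrow> q \<preceq> w \<Longrightarrow> q \<in> fund_D"
  by (auto simp: fund_D_iff strip_le_def)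

text \<open>Both ends of D matter: x - y < 2 pi at p makes the two intervals of \<open>rho1\<close>
  overlap, so that their union is an interval, and y \<le> x at w keeps opposite rays of
  \<open>rho0\<close> disjoint, so that their intersection has no extra part.\<close>

lemma
  assumes "continuous_map X euclideanreal f"
    and D: "w \<in> fund_D" "p \<in> fund_D" and le: "w \<preceq> strip_T p" "p \<preceq> w"
  shows rect_un: "pair_un (level_pair f (fst w, snd p)) (level_pair f (fst p, snd w)) = level_pair f w"
    and rect_int: "pair_int (level_pair f (fst w, snd p)) (level_pair f (fst p, snd w)) = level_pair f p"
    and rect_cover: "mv_cover (level_pair f w)
      (level_pair f (fst w, snd p)) (level_pair f (fst p, snd w)) (level_pair f p)"
proof -
  have arith: "fst w \<le> fst p" "snd p \<le> snd w" "snd w \<le> fst w" "fst p - snd p < 2 * pi"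
    using D le by (auto simp: fund_D_iff strip_le_def)
  show un: "pair_un (level_pair f (fst w, snd p)) (level_pair f (fst p, snd w)) = level_pair f w"
  proof -
    have "(- pi - snd p < t \<and> t < pi - fst w) \<or> (- pi - snd w < t \<and> t < pi - fst p) \<longleftrightarrow>
        - pi - snd w < t \<and> t < pi - fst w" for t :: real
      using arith by linarith
    moreover have "(t < snd p \<or> fst w < t) \<or> (t < snd w \<or> fst p < t) \<longleftrightarrow> t < snd w \<or> fst w < t"
      for t :: real
      using arith by linarith
    ultimately show ?thesis
      unfolding prod_eq_iff pair_un_def fst_conv snd_conv level_pair_simps by blast
  qed
  show int: "pair_int (level_pair f (fst w, snd p)) (level_pair f (fst p, snd w)) = level_pair f p"
  proof -
    have "(- pi - snd p < t \<and> t < pi - fst w) \<and> (- pi - snd w < t \<and> t < pi - fst p) \<longleftrightarrow>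
        - pi - snd p < t \<and> t < pi - fst p" for t :: real
      using arith by linarith
    moreover have "(t < snd p \<or> fst w < t) \<and> (t < snd w \<or> fst p < t) \<longleftrightarrow> t < snd p \<or> fst p < t"
      for t :: real
      using arith by linarith
    ultimately show ?thesis
      unfolding prod_eq_iff pair_int_def fst_conv snd_conv level_pair_simps by blast
  qed
  show "mv_cover (level_pair f w)
      (level_pair f (fst w, snd p)) (level_pair f (fst p, snd w)) (level_pair f p)"
    using D open_level_pair[OF assms(1)] rect_corners_in_strip[OF D le]
    by (simp add: mv_cover_def un int fund_D_iff)
qed

text \<open>If w is below u, the rectangle from w to u refines the one from w to v. Otherwise u lies
  below one of the two remaining corners of the latter, so its pair is contained in a member of the
  cover.\<close>

lemma restr_rect_mv:
  assumes f: "continuous_map X euclideanreal f"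
    and D: "u \<in> fund_D" "v \<in> fund_D" "w \<in> fund_D"
    and le: "u \<preceq> v" "v \<preceq> strip_T w" "w \<preceq> v"
    and z: "z \<in> carrier (hcoh (n - 1) (level_pair f w))"
  shows "restr n (level_pair f u) (level_pair f v) (rect_mv f n v w z) =
    (if w \<preceq> u then rect_mv f n u w z else \<zero>\<^bsub>hcoh n (level_pair f u)\<^esub>)"
proof -
  have o: "open_pair X (level_pair f u)"
    using D f by (simp add: fund_D_iff open_level_pair)
  note cv = rect_cover[OF f D(2,3) le(2,3)]
  have eq: "restr n (level_pair f u) (level_pair f v) (rect_mv f n v w z) =
      mv_through n (level_pair f u) (level_pair f (fst v, snd w)) (level_pair f (fst w, snd v))
        (level_pair f w) z"
    by (intro restr_mv_through cv z o level_pair_mono le)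
  have cvu: "mv_cover (level_pair f u) (level_pair f (fst v, snd w)) (level_pair f (fst w, snd v)) (level_pair f w)"
    using cv o level_pair_mono[OF le(1), of f] pair_le_trans unfolding mv_cover_def by blast
  show ?thesis
  proof (cases "w \<preceq> u")
    case True
    have "u \<preceq> strip_T w"
      using le strip_le_trans by blast
    from mv_through_refine[OF rect_cover[OF f D(1,3) this True] cvu _ _ z]
    show ?thesis
      using le(1) True by (simp add: eq level_pair_mono strip_le_def)
  next
    case False
    then have "u \<preceq> (fst v, snd w) \<or> u \<preceq> (fst w, snd v)"
      using le by (auto simp: strip_le_def)
    then show ?thesis
      using False level_pair_mono[of _ _ f] by (simp add: eq) (blast intro: mv_through_zero[OF cvu z])
  qed
qed

text \<open>The mirror image of \<open>restr_rect_mv\<close> on the source side: if w is not below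
  u, then w lies above one of the two remaining corners, so its pair contains a member of the
  cover.\<close>

lemma rect_mv_restr:
  assumes f: "continuous_map X euclideanreal f"
    and D: "u \<in> fund_D" "v \<in> fund_D" "w \<in> fund_D"
    and le: "v \<preceq> w" "u \<preceq> strip_T v" "v \<preceq> u"
    and z: "z \<in> carrier (hcoh (n - 1) (level_pair f w))"
  shows "rect_mv f n u v (restr (n - 1) (level_pair f v) (level_pair f w) z) =
    (if w \<preceq> u then rect_mv f n u w z else \<zero>\<^bsub>hcoh n (level_pair f u)\<^esub>)"
proof -
  have o: "open_pair X (level_pair f w)"
    using D f by (simp add: fund_D_iff open_level_pair)
  note cv = rect_cover[OF f D(1,2) le(2,3)]
  have eq: "rect_mv f n u v (restr (n - 1) (level_pair f v) (level_pair f w) z) =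
      mv_through n (level_pair f u) (level_pair f (fst u, snd v)) (level_pair f (fst v, snd u))
        (level_pair f w) z"
    by (intro mv_through_restr cv z o level_pair_mono le)
  have cvu: "mv_cover (level_pair f u) (level_pair f (fst u, snd v)) (level_pair f (fst v, snd u)) (level_pair f w)"
    using cv o level_pair_mono[OF le(1), of f] pair_le_trans unfolding mv_cover_def by blast
  show ?thesis
  proof (cases "w \<preceq> u")
    case True
    have "u \<preceq> strip_T w"
      using le strip_le_trans strip_T_le_iff by blast
    from mv_through_refine[OF cvu rect_cover[OF f D(1,3) this True] _ _ z]
    show ?thesis
      using le(1) True by (simp add: eq level_pair_mono strip_le_def)
  next
    case False
    then have "(fst u, snd v) \<preceq> w \<or> (fst v, snd u) \<preceq> w"
      using le by (auto simp: strip_le_def)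
    then show ?thesis
      using False level_pair_mono[of _ _ f] by (simp add: eq) (blast intro: mv_through_zero[OF cvu z])
  qed
qed

text \<open>One of the two remaining corners of the rectangle from \<open>v\<close> to \<open>u\<close> lies below \<open>T(w)\<close>,
  since \<open>w\<close> and \<open>u\<close> both lie in \<open>D\<close>. The inner differential extends to that corner, and the
  outer one annihilates everything coming from there.\<close>

lemma rect_mv_rect_mv:
  assumes f: "continuous_map X euclideanreal f"
    and D: "u \<in> fund_D" "v \<in> fund_D" "w \<in> fund_D"
    and le: "u \<preceq> strip_T v" "v \<preceq> u" "v \<preceq> strip_T w" "w \<preceq> v"
    and z: "z \<in> carrier (hcoh (n - 1 - 1) (level_pair f w))"
  shows "rect_mv f n u v (rect_mv f (n - 1) v w z) = \<zero>\<^bsub>hcoh n (level_pair f u)\<^esub>"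
proof -
  have "\<exists>q. (q = (fst u, snd v) \<or> q = (fst v, snd u)) \<and> q \<preceq> strip_T w"
  proof (cases "- pi - snd w \<le> fst u")
    case True
    then show ?thesis
      using le by (intro exI[of _ "(fst u, snd v)"]) (simp add: strip_le_def)
  next
    case False
    then show ?thesis
      using D le by (intro exI[of _ "(fst v, snd u)"]) (simp add: strip_le_def fund_D_iff)
  qed
  then obtain q where q: "q = (fst u, snd v) \<or> q = (fst v, snd u)" "q \<preceq> strip_T w"
    by blast
  have vq: "v \<preceq> q" and qu: "q \<preceq> u"
    using q(1) le(2) by (auto simp: strip_le_def)
  have qD: "q \<in> fund_D"
    using fund_D_convex[OF D(2,1) _ vq qu] q(1) rect_corners_in_strip[OF D(1,2) le(1,2)] by blast
  have wq: "w \<preceq> q"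
    using le(4) vq strip_le_trans by blast
  have o: "open_pair X (level_pair f q)"
    using qD f by (simp add: fund_D_iff open_level_pair)
  define y where "y = rect_mv f (n - 1) q w z"
  have y: "y \<in> carrier (hcoh (n - 1) (level_pair f q))"
    unfolding y_def by (intro mv_through_in rect_cover f qD D q wq z)
  have "rect_mv f (n - 1) v w z = restr (n - 1) (level_pair f v) (level_pair f q) y"
    using restr_rect_mv[OF f D(2) qD D(3) vq q(2) wq z] le(4) by (simp add: y_def)
  moreover note cv = rect_cover[OF f D(1,2) le(1,2)]
  ultimately have eq: "rect_mv f n u v (rect_mv f (n - 1) v w z) =
      mv_through n (level_pair f u) (level_pair f (fst u, snd v)) (level_pair f (fst v, snd u))
        (level_pair f q) y"
    using mv_through_restr[OF cv y o level_pair_mono[OF vq]] by simp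
  have "mv_cover (level_pair f u) (level_pair f (fst u, snd v)) (level_pair f (fst v, snd u)) (level_pair f q)"
    using cv o level_pair_mono[OF vq, of f] pair_le_trans unfolding mv_cover_def by blast
  from mv_through_zero[OF this y] q(1) show ?thesis
    by (auto simp: eq)
qed

section \<open>Internal maps of h(f) in terms of representatives in D\<close>

abbreviation rep :: "real \<times> real \<Rightarrow> real \<times> real" where
  "rep u \<equiv> strip_T_pow (tile u) u"

lemma rep_in_fund_D: "u \<in> strip \<Longrightarrow> rep u \<in> fund_D"
  using tile_eq_iff by blast

lemma h_obj: "fobj (h C X f) u = hcoh (tile u) (level_pair f (rep u))"
  by (simp add: h_def Let_def level_pair_def)

lemma rep_le_T_rep:
  assumes "tile v = tile u - 1"
  shows "rep u \<preceq> strip_T (rep v) \<longleftrightarrow> u \<preceq> v" and "rep v \<preceq> rep u \<longleftrightarrow> v \<preceq> strip_T u"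
proof -
  have "strip_T (rep v) = strip_T_pow (tile u) v" and r: "rep u = strip_T_pow (tile v) (strip_T u)"
    using strip_T_pow_Suc[of "tile v" v] strip_T_pow_Suc[of "tile v" u] assms
    by (simp_all add: strip_T_pow_T)
  then show "rep u \<preceq> strip_T (rep v) \<longleftrightarrow> u \<preceq> v" "rep v \<preceq> rep u \<longleftrightarrow> v \<preceq> strip_T u"
    by (metis strip_T_pow_le_iff)+
qed

lemma h_map_same:
  "tile v = tile u \<Longrightarrow>
   fmap (h C X f) u v = restr (tile u) (level_pair f (rep u)) (level_pair f (rep v))"
  by (simp add: h_def Let_def level_pair_def)

lemma h_map_zero:
  assumes "u \<in> strip" "v \<in> strip" "tile v \<noteq> tile u" "\<not> v \<preceq> strip_T u"
  shows "fmap (h C X f) u v = (\<lambda>z. \<zero>\<^bsub>fobj (h C X f) u\<^esub>)"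
  using assms by (simp add: h_def Let_def)

lemma tile_eq_pred:
  assumes "u \<in> strip" "v \<in> strip" "u \<preceq> v" "v \<preceq> strip_T u" "tile v \<noteq> tile u"
  shows "tile v = tile u - 1"
  using tile_antimono[OF assms(1-3)] tile_ge_if_le_T[OF assms(1,2,4)] assms(5) by simp

lemma rep_rect:
  assumes "u \<in> strip" "v \<in> strip" "u \<preceq> v" "v \<preceq> strip_T u" "tile v \<noteq> tile u"
  shows "rep u \<in> fund_D" "rep v \<in> fund_D" "rep u \<preceq> strip_T (rep v)" "rep v \<preceq> rep u"
  using assms rep_in_fund_D rep_le_T_rep[OF tile_eq_pred[OF assms]] by blast+

lemma h_map_rect:
  assumes "continuous_map X euclideanreal f"
    and uv: "u \<in> strip" "v \<in> strip" "u \<preceq> v" "v \<preceq> strip_T u" "tile v \<noteq> tile u"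
    and z: "z \<in> carrier (fobj (h C X f) v)"
  shows "fmap (h C X f) u v z = rect_mv f (tile u) (rep u) (rep v) z"
proof -
  note t = tile_eq_pred[OF uv] and r = rep_rect[OF uv]
  have "fmap (h C X f) u v z = mv_diff C (tile u) X (level_pair f (fst (rep u), snd (rep v)))
      (level_pair f (fst (rep v), snd (rep u))) z"
    using uv t by (simp add: h_def Let_def mv_rect_def level_pair_def)
  also have "\<dots> = rect_mv f (tile u) (rep u) (rep v) z"
    using mv_diff_eq_mv_through[of "level_pair f (fst (rep u), snd (rep v))"
        "level_pair f (fst (rep v), snd (rep u))" z "tile u"]
      rect_un[OF assms(1) r] rect_int[OF assms(1) r] mv_coverD(2,3)[OF rect_cover[OF assms(1) r]] z
    by (simp add: h_obj t)
  finally show ?thesis .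
qed

lemma open_rep:
  "continuous_map X euclideanreal f \<Longrightarrow> u \<in> strip \<Longrightarrow> open_pair X (level_pair f (rep u))"
  by (simp add: open_level_pair)

lemma module_h:
  "continuous_map X euclideanreal f \<Longrightarrow> u \<in> strip \<Longrightarrow> Module.module K (fobj (h C X f) u)"
  by (simp add: h_obj module_hcoh open_level_pair)

lemma mv_through_linear:
  assumes "mv_cover W P Q R"
  shows "linear_map K (hcoh (n - 1) R) (hcoh n W) (mv_through n W P Q R)"
proof -
  note c = mv_coverD[OF assms]
  have "linear_map K (hcoh (n - 1) R) (hcoh n W)
      (restr n W (pair_un P Q) \<circ> (mv_diff C n X P Q \<circ> restr (n - 1) (pair_int P Q) R))"
    by (rule linear_map_comp[OF linear_map_comp[OF restr_linear[OF c(6,4,8)] mv_linear[OF c(2,3)]]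
        restr_linear[OF c(1,5,7)]])
  then show ?thesis
    by (simp add: mv_through_def[abs_def] comp_def)
qed

lemma h_map_linear:
  assumes f: "continuous_map X euclideanreal f" and uv: "u \<in> strip" "v \<in> strip" "u \<preceq> v"
  shows "linear_map K (fobj (h C X f) v) (fobj (h C X f) u) (fmap (h C X f) u v)"
proof (cases "tile v = tile u")
  case True
  then show ?thesis
    using restr_linear[OF open_rep[OF f uv(1)] open_rep[OF f uv(2)] level_pair_mono, of "tile u"] uv
    by (simp add: h_map_same h_obj)
next
  case False
  show ?thesis
  proof (cases "v \<preceq> strip_T u")
    case True
    note r = uv True False
    have "linear_map K (fobj (h C X f) v) (fobj (h C X f) u) (rect_mv f (tile u) (rep u) (rep v))"
      using mv_through_linear[OF rect_cover[OF f rep_rect[OF r]], of "tile u"] tile_eq_pred[OF r]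
      by (simp add: h_obj)
    then show ?thesis
      using h_map_rect[OF f r] by (rule linear_map_cong) (auto intro: module_h f uv)
  next
    case nle: False
    show ?thesis
      unfolding h_map_zero[OF uv(1,2) False nle]
      by (intro linear_map_const_zero module_h f uv)
  qed
qed

lemma h_map_comp:
  assumes f: "continuous_map X euclideanreal f"
    and s: "u \<in> strip" "v \<in> strip" "w \<in> strip" and uv: "u \<preceq> v" and vw: "v \<preceq> w"
    and z: "z \<in> carrier (fobj (h C X f) w)"
  shows "fmap (h C X f) u w z = fmap (h C X f) u v (fmap (h C X f) v w z)"
proof -
  have uw: "u \<preceq> w"
    using uv vw strip_le_trans by blast
  have tuv: "tile v \<le> tile u" and tvw: "tile w \<le> tile v"
    using tile_antimono s uv vw by blast+
  note lin = h_map_linear[OF f s(1,2) uv] and vz = linear_map_in_carrier[OF h_map_linear[OF f s(2,3) vw] z]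
  have fmap0: "fmap (h C X f) u v \<zero>\<^bsub>fobj (h C X f) v\<^esub> = \<zero>\<^bsub>fobj (h C X f) u\<^esub>"
    using linear_map_zero[OF lin] module_h f s by blast
  \<comment> \<open>Each factor is zero by definition, a restriction, or a differential. If one of
    them is zero by definition, so is the composite: w below T(u) would put v below T(u) and w below
    T(v).\<close>
  consider (vw) "tile w \<noteq> tile v" "\<not> w \<preceq> strip_T v" | (uv) "tile v \<noteq> tile u" "\<not> v \<preceq> strip_T u"
    | (eq) "tile v = tile u" "tile w = tile v"
    | (left) "tile v = tile u" "tile w \<noteq> tile v" "w \<preceq> strip_T v"
    | (right) "tile v \<noteq> tile u" "tile w = tile v" "v \<preceq> strip_T u"
    | (both) "tile v \<noteq> tile u" "tile w \<noteq> tile v" "v \<preceq> strip_T u" "w \<preceq> strip_T v"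
    by blast
  then show ?thesis
  proof cases
    case vw
    have "\<not> w \<preceq> strip_T u"
      using vw(2) uv strip_le_trans strip_T_le_iff by blast
    moreover have "tile w \<noteq> tile u"
      using tuv tvw vw(1) by simp
    ultimately show ?thesis
      using h_map_zero[OF s(1,3)] h_map_zero[OF s(2,3) vw] fmap0 by simp
  next
    case uv
    have "\<not> w \<preceq> strip_T u"
      using uv(2) vw strip_le_trans by blast
    moreover have "tile w \<noteq> tile u"
      using tuv tvw uv(1) by simp
    ultimately show ?thesis
      using h_map_zero[OF s(1,3)] h_map_zero[OF s(1,2) uv] by simp
  next
    case eq
    then have "restr (tile u) (level_pair f (rep u)) (level_pair f (rep v))
        (restr (tile u) (level_pair f (rep v)) (level_pair f (rep w)) z) =
        restr (tile u) (level_pair f (rep u)) (level_pair f (rep w)) z"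
      using z uv vw by (intro restr_restr open_rep f s level_pair_mono) (simp_all add: h_obj)
    with eq show ?thesis
      by (simp add: h_map_same)
  next
    case left
    note r = s(2,3) vw left(3,2)
    have "restr (tile u) (level_pair f (rep u)) (level_pair f (rep v)) (rect_mv f (tile u) (rep v) (rep w) z) =
        (if rep w \<preceq> rep u then rect_mv f (tile u) (rep u) (rep w) z
         else \<zero>\<^bsub>hcoh (tile u) (level_pair f (rep u))\<^esub>)"
      using rep_rect[OF r] z left tile_eq_pred[OF r] uv s
      by (intro restr_rect_mv f) (simp_all add: rep_in_fund_D h_obj)
    moreover have "tile w = tile u - 1"
      using tile_eq_pred[OF r] left(1) by simp
    ultimately show ?thesis
      using h_map_rect[OF f r z] h_map_zero[OF s(1,3), of f] h_map_rect[OF f s(1,3) uw _ _ z]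
        rep_le_T_rep(2)[of w u] left
      by (simp add: h_map_same h_obj split: if_splits)
  next
    case right
    note r = s(1,2) uv right(3,1)
    have t: "tile v = tile u - 1" "tile w = tile u - 1"
      using tile_eq_pred[OF r] right(2) by simp_all
    then have twu: "tile w \<noteq> tile u"
      by simp
    have "fmap (h C X f) u v (fmap (h C X f) v w z) = rect_mv f (tile u) (rep u) (rep v)
        (restr (tile u - 1) (level_pair f (rep v)) (level_pair f (rep w)) z)"
      using h_map_rect[OF f r vz] h_map_same[OF right(2), of f] by (simp only: t(1))
    also have "\<dots> = (if rep w \<preceq> rep u then rect_mv f (tile u) (rep u) (rep w) z
         else \<zero>\<^bsub>hcoh (tile u) (level_pair f (rep u))\<^esub>)"
      using rep_rect[OF r] rep_in_fund_D[OF s(3)] z vw right(2)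
      by (intro rect_mv_restr f) (simp_all only: h_obj t strip_T_pow_le_iff)
    also have "\<dots> = fmap (h C X f) u w z"
    proof (cases "w \<preceq> strip_T u")
      case True
      then show ?thesis
        using h_map_rect[OF f s(1,3) uw True twu z] rep_le_T_rep(2)[OF t(2)]
        by (simp only: if_True)
    next
      case False
      then show ?thesis
        using h_map_zero[OF s(1,3) twu False] rep_le_T_rep(2)[OF t(2)]
        by (simp only: if_False h_obj)
    qed
    finally show ?thesis by simp
  next
    case both
    note r = s(1,2) uv both(3,1) and r' = s(2,3) vw both(4,2)
    have t: "tile v = tile u - 1" "tile w = tile u - 1 - 1"
      using tile_eq_pred[OF r] tile_eq_pred[OF r'] by simp_all
    have "rect_mv f (tile u) (rep u) (rep v) (rect_mv f (tile u - 1) (rep v) (rep w) z) =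
        \<zero>\<^bsub>hcoh (tile u) (level_pair f (rep u))\<^esub>"
      using rep_rect[OF r] rep_rect[OF r'] z by (intro rect_mv_rect_mv f) (simp_all only: h_obj t)
    then have "fmap (h C X f) u v (fmap (h C X f) v w z) = \<zero>\<^bsub>fobj (h C X f) u\<^esub>"
      using h_map_rect[OF f r vz] h_map_rect[OF f r' z] by (simp only: h_obj t)
    \<comment> \<open>Two differentials in succession put w two tiles away from u, out of reach of a
      nonzero internal map.\<close>
    moreover have "\<not> w \<preceq> strip_T u"
      using tile_ge_if_le_T[OF s(1,3)] t by auto
    ultimately show ?thesis
      using h_map_zero[OF s(1,3)] t by simp
  qed
qed

lemma h_map_id:
  assumes "continuous_map X euclideanreal f" and "u \<in> strip" and "z \<in> carrier (fobj (h C X f) u)"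
  shows "fmap (h C X f) u u z = z"
  using restr_self[OF open_rep[OF assms(1,2)]] assms(3) by (simp add: h_map_same h_obj)

lemma h_functor:
  assumes f: "continuous_map X euclideanreal f"
  shows "is_strip_functor K (h C X f)"
  unfolding is_strip_functor_def
  by (intro conjI ballI impI module_h[OF f] h_map_linear[OF f] h_map_id[OF f] h_map_comp[OF f])

section \<open>The transformation \<open>vec_h\<close>\<close>

text \<open>These are the properties of a = d(f,g) that the geometry uses. The inequality between
  the components of a is listed separately, as on an empty space the pointwise bounds would not
  imply it.\<close>

definition shift_bounded :: "('a \<Rightarrow> real) \<Rightarrow> ('a \<Rightarrow> real) \<Rightarrow> real \<times> real \<Rightarrow> bool" where
  "shift_bounded f g a \<longleftrightarrow> continuous_map X euclideanreal f \<and> continuous_map X euclideanreal g \<and>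
     fst a \<le> snd a \<and> (\<forall>x\<in>topspace X. fst a \<le> g x - f x \<and> g x - f x \<le> snd a)"

lemma shift_boundedD:
  assumes "shift_bounded f g a"
  shows "continuous_map X euclideanreal f" "continuous_map X euclideanreal g" "fst a \<le> snd a"
  using assms by (auto simp: shift_bounded_def)

text \<open>All four thresholds in the definition of \<open>rho\<close> are \<open>g_tilde\<close>
  values up to a constant, so the two one-sided estimates suffice. The last threshold is a shift by
  2 pi and needs periodicity.\<close>

lemma shift_bounds:
  assumes "shift_bounded f g a" and "x \<in> topspace X"
  shows "arctan (f x) < snd u \<Longrightarrow> arctan (g x) < snd (alpha a u)"
    and "fst u < arctan (f x) \<Longrightarrow> fst (alpha a u) < arctan (g x)"
    and "arctan (f x) < pi - fst u \<Longrightarrow> arctan (g x) < pi - fst (alpha a u)"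
    and "- pi - snd u < arctan (f x) \<Longrightarrow> - pi - snd (alpha a u) < arctan (g x)"
proof -
  have gf: "fst a \<le> g x - f x" "g x - f x \<le> snd a"
    using assms by (auto simp: shift_bounded_def)
  note up = arctan_less_g_tilde[OF _ gf(2)] and down = g_tilde_less_arctan[OF _ gf(1)]
  show "arctan (f x) < snd u \<Longrightarrow> arctan (g x) < snd (alpha a u)"
    "fst u < arctan (f x) \<Longrightarrow> fst (alpha a u) < arctan (g x)"
    "arctan (f x) < pi - fst u \<Longrightarrow> arctan (g x) < pi - fst (alpha a u)"
    using up[of "snd u"] up[of "pi - fst u"] down[of "pi - fst u"] by simp_all
  show "- pi - snd u < arctan (f x) \<Longrightarrow> - pi - snd (alpha a u) < arctan (g x)"
    using down[of "snd u + 2 * pi"] by (simp add: g_tilde_periodic)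
qed

lemma level_pair_shift:
  assumes "shift_bounded f g a"
  shows "pair_le (level_pair f u) (level_pair g (alpha a u))"
  using shift_bounds[OF assms] unfolding pair_le_def level_pair_simps by blast

section \<open>Mixed covers by superlevel and sublevel sets\<close>

text \<open>The pair that \<open>\<xi>\<close> in \<open>vec_h\<close> attaches to the lower left
  corner (x, -pi - x) of the rectangle at u = (x, y), in the case that \<open>alpha a u\<close> has
  left D; \<open>vec_h_shift\<close> proves this. \<open>upper_mixed\<close> belongs to the upper
  right corner (pi - y, y).\<close>

definition lower_mixed ::
    "('a \<Rightarrow> real) \<Rightarrow> ('a \<Rightarrow> real) \<Rightarrow> real \<times> real \<Rightarrow> real \<times> real \<Rightarrow> 'a set \<times> 'a set" where
  "lower_mixed f g a u = ({x \<in> topspace X. fst (alpha a u) < arctan (g x)},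
     {x \<in> topspace X. fst u < arctan (f x)})"

definition upper_mixed ::
    "('a \<Rightarrow> real) \<Rightarrow> ('a \<Rightarrow> real) \<Rightarrow> real \<times> real \<Rightarrow> real \<times> real \<Rightarrow> 'a set \<times> 'a set" where
  "upper_mixed f g a u = ({x \<in> topspace X. arctan (g x) < snd (alpha a u)},
     {x \<in> topspace X. arctan (f x) < snd u})"

abbreviation mixed_mv ::
    "('a \<Rightarrow> real) \<Rightarrow> ('a \<Rightarrow> real) \<Rightarrow> real \<times> real \<Rightarrow> int \<Rightarrow> real \<times> real \<Rightarrow> 'v \<Rightarrow> 'v" where
  "mixed_mv f g a n u \<equiv> mv_through n (level_pair f u) (lower_mixed f g a u) (upper_mixed f g a u)
     (level_pair g (strip_T_inv (alpha a u)))"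

lemma mixed_simps:
  "fst (lower_mixed f g a u) = {x \<in> topspace X. fst (alpha a u) < arctan (g x)}"
  "snd (lower_mixed f g a u) = {x \<in> topspace X. fst u < arctan (f x)}"
  "fst (upper_mixed f g a u) = {x \<in> topspace X. arctan (g x) < snd (alpha a u)}"
  "snd (upper_mixed f g a u) = {x \<in> topspace X. arctan (f x) < snd u}"
  by (simp_all add: lower_mixed_def upper_mixed_def)

lemma open_mixed:
  assumes "shift_bounded f g a"
  shows "open_pair X (lower_mixed f g a u)" "open_pair X (upper_mixed f g a u)"
  using shift_boundedD(1,2)[OF assms] shift_bounds(1,2)[OF assms, of _ u]
  by (auto simp: open_pair_def mixed_simps openin_less_arctan simp del: alpha_simps)

lemmas pair_simps = pair_le_def pair_un_def pair_int_def level_pair_simps mixed_simps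
  fst_conv snd_conv strip_T_inv_simps Un_iff Int_iff mem_Collect_eq

lemma pair_leI:
  assumes "fst P \<subseteq> topspace X" "snd P \<subseteq> topspace X"
    and "\<And>x. x \<in> topspace X \<Longrightarrow> x \<in> fst P \<Longrightarrow> x \<in> fst Q"
    and "\<And>x. x \<in> topspace X \<Longrightarrow> x \<in> snd P \<Longrightarrow> x \<in> snd Q"
  shows "pair_le P Q"
  using assms by (auto simp: pair_le_def)

lemma pair_eqI:
  assumes "fst P \<subseteq> topspace X" "snd P \<subseteq> topspace X" "fst Q \<subseteq> topspace X" "snd Q \<subseteq> topspace X"
    and "\<And>x. x \<in> topspace X \<Longrightarrow> x \<in> fst P \<longleftrightarrow> x \<in> fst Q"
    and "\<And>x. x \<in> topspace X \<Longrightarrow> x \<in> snd P \<longleftrightarrow> x \<in> snd Q"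
  shows "P = Q"
  using assms by (auto simp: prod_eq_iff)

text \<open>In the open square, the first component of the pair of f at u is all of X, and the
  second component of the pair of g at the lower corner is empty. The image being strictly above the
  diagonal makes the two sets of g cover X; u not being above it makes the two sets of f
  disjoint.\<close>

lemma
  assumes sb: "shift_bounded f g a" and u: "u \<in> fund_D" "alpha a u \<notin> fund_D"
  shows mixed_un: "pair_un (lower_mixed f g a u) (upper_mixed f g a u) = level_pair f u"
    and mixed_int: "pair_int (lower_mixed f g a u) (upper_mixed f g a u) =
      level_pair g (strip_T_inv (alpha a u))"
    and mixed_cover: "mv_cover (level_pair f u) (lower_mixed f g a u) (upper_mixed f g a u)
      (level_pair g (strip_T_inv (alpha a u)))"
proof -
  note leave = alpha_leaves_fund_D[OF shift_boundedD(3)[OF sb] u]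
  have "snd u \<le> fst u"
    using u by (simp add: fund_D_iff)
  note arith = this leave(1,3-10)
  show un: "pair_un (lower_mixed f g a u) (upper_mixed f g a u) = level_pair f u"
  proof (rule pair_eqI)
    fix x assume "x \<in> topspace X"
    note facts = this arith arctan_bounded[of "f x"] arctan_bounded[of "g x"]
    show "x \<in> fst (pair_un (lower_mixed f g a u) (upper_mixed f g a u)) \<longleftrightarrow> x \<in> fst (level_pair f u)"
      using facts unfolding pair_simps by argo
    show "x \<in> snd (pair_un (lower_mixed f g a u) (upper_mixed f g a u)) \<longleftrightarrow> x \<in> snd (level_pair f u)"
      using facts unfolding pair_simps by argo
  qed (auto simp: pair_simps)
  show int: "pair_int (lower_mixed f g a u) (upper_mixed f g a u) =
      level_pair g (strip_T_inv (alpha a u))"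
  proof (rule pair_eqI)
    fix x assume "x \<in> topspace X"
    note facts = this arith arctan_bounded[of "f x"] arctan_bounded[of "g x"]
    show "x \<in> fst (pair_int (lower_mixed f g a u) (upper_mixed f g a u)) \<longleftrightarrow>
        x \<in> fst (level_pair g (strip_T_inv (alpha a u)))"
      using facts unfolding pair_simps by argo
    show "x \<in> snd (pair_int (lower_mixed f g a u) (upper_mixed f g a u)) \<longleftrightarrow>
        x \<in> snd (level_pair g (strip_T_inv (alpha a u)))"
      using facts unfolding pair_simps by argo
  qed (auto simp: pair_simps)
  show "mv_cover (level_pair f u) (lower_mixed f g a u) (upper_mixed f g a u)
      (level_pair g (strip_T_inv (alpha a u)))"
    using u(1) leave(2) shift_boundedD(1,2)[OF sb]
    by (simp add: mv_cover_def open_mixed[OF sb] open_level_pair un int fund_D_iff)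
qed

lemma mv_cover_mono:
  "mv_cover W P Q R \<Longrightarrow> open_pair X W' \<Longrightarrow> pair_le W' W \<Longrightarrow> open_pair X R' \<Longrightarrow> pair_le R R' \<Longrightarrow>
   mv_cover W' P Q R'"
  unfolding mv_cover_def using pair_le_trans by blast

lemma open_level_pair_D:
  "continuous_map X euclideanreal f \<Longrightarrow> u \<in> fund_D \<Longrightarrow> open_pair X (level_pair f u)"
  by (simp add: open_level_pair fund_D_iff)

section \<open>Naturality squares for representatives in D\<close>

text \<open>The square in which only the image of v leaves D. The mixed cover at v and the rectangle
  cover of g have a common refinement over the pair of f at u; in the vanishing case that pair lies
  in one mixed member.\<close>

lemma restr_mixed_mv:
  assumes sb: "shift_bounded f g a"
    and D: "u \<in> fund_D" "v \<in> fund_D" "alpha a u \<in> fund_D" "alpha a v \<notin> fund_D"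
    and le: "u \<preceq> v" and z: "z \<in> carrier (hcoh (n - 1) (level_pair g (strip_T_inv (alpha a v))))"
  shows "restr n (level_pair f u) (level_pair f v) (mixed_mv f g a n v z) =
    (if strip_T_inv v \<preceq> u
     then restr n (level_pair f u) (level_pair g (alpha a u))
       (rect_mv g n (alpha a u) (strip_T_inv (alpha a v)) z)
     else \<zero>\<^bsub>hcoh n (level_pair f u)\<^esub>)"
proof -
  note f = shift_boundedD(1)[OF sb] and g = shift_boundedD(2)[OF sb]
  note leave = alpha_leaves_fund_D[OF shift_boundedD(3)[OF sb] D(2,4)]
  note ou = open_level_pair_D[OF f D(1)]
  note cv = mixed_cover[OF sb D(2,4)]
  note eq = restr_mv_through[OF cv z ou level_pair_mono[OF le]]
  note cvu = mv_cover_mono[OF cv ou level_pair_mono[OF le] mv_coverD(4)[OF cv] pair_le_refl]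
  have le_a: "alpha a u \<preceq> alpha a v"
    using le by simp
  show ?thesis
  proof (cases "strip_T_inv v \<preceq> u")
    case True
    then have 1: "strip_T_inv (alpha a v) \<preceq> alpha a u" "alpha a u \<preceq> strip_T (strip_T_inv (alpha a v))"
      using le_a by (simp_all add: strip_T_inv_alpha_le_iff)
    note cv' = rect_cover[OF g D(3) leave(2) 1(2,1)]
    note cvu' = mv_cover_mono[OF cv' ou level_pair_shift[OF sb] mv_coverD(4)[OF cv'] pair_le_refl]
    have "mv_through n (level_pair f u) (lower_mixed f g a v) (upper_mixed f g a v)
          (level_pair g (strip_T_inv (alpha a v))) z =
        mv_through n (level_pair f u) (level_pair g (fst (alpha a u), snd (strip_T_inv (alpha a v))))
          (level_pair g (fst (strip_T_inv (alpha a v)), snd (alpha a u)))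
          (level_pair g (strip_T_inv (alpha a v))) z"
    proof (rule mv_through_eqI[OF cvu cvu' z pair_leI])
      fix x assume x: "x \<in> topspace X"
      note facts = x le[unfolded strip_le_def] le_a[unfolded strip_le_def] leave(1)
        shift_bounds[OF sb x, of u] arctan_bounded[of "f x"] arctan_bounded[of "g x"]
      show "x \<in> fst (pair_un
          (pair_int (lower_mixed f g a v) (level_pair g (fst (alpha a u), snd (strip_T_inv (alpha a v)))))
          (pair_int (upper_mixed f g a v) (level_pair g (fst (strip_T_inv (alpha a v)), snd (alpha a u)))))"
        if "x \<in> fst (level_pair f u)"
        using facts that unfolding pair_simps by argo
      show "x \<in> snd (pair_un
          (pair_int (lower_mixed f g a v) (level_pair g (fst (alpha a u), snd (strip_T_inv (alpha a v)))))
          (pair_int (upper_mixed f g a v) (level_pair g (fst (strip_T_inv (alpha a v)), snd (alpha a u)))))"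
        if "x \<in> snd (level_pair f u)"
        using facts that unfolding pair_simps by argo
    qed (auto simp: level_pair_simps)
    then show ?thesis
      using eq True restr_mv_through[OF cv' z ou level_pair_shift[OF sb]] by simp
  next
    case False
    \<comment> \<open>The two ways in which \<open>strip_T_inv v\<close> can fail to be below u, one
      per coordinate; they decide which mixed member contains the pair at u.\<close>
    then consider "fst v < - pi - snd u" | "pi - fst u < snd v"
      by (auto simp: strip_le_def)
    then have "pair_le (level_pair f u) (lower_mixed f g a v) \<or> pair_le (level_pair f u) (upper_mixed f g a v)"
    proof cases
      case 1
      have "pair_le (level_pair f u) (lower_mixed f g a v)"
      proof (rule pair_leI)
        fix x assume x: "x \<in> topspace X"
        note facts = x 1 le[unfolded strip_le_def] leave(4,5)
          shift_bounds[OF sb x, of v] arctan_bounded[of "f x"] arctan_bounded[of "g x"]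
        show "x \<in> fst (lower_mixed f g a v)" if "x \<in> fst (level_pair f u)"
          using facts that unfolding pair_simps by argo
        show "x \<in> snd (lower_mixed f g a v)" if "x \<in> snd (level_pair f u)"
          using facts that unfolding pair_simps by argo
      qed (auto simp: level_pair_simps)
      then show ?thesis ..
    next
      case 2
      have "pair_le (level_pair f u) (upper_mixed f g a v)"
      proof (rule pair_leI)
        fix x assume x: "x \<in> topspace X"
        note facts = x 2 le[unfolded strip_le_def] leave(5)
          shift_bounds[OF sb x, of v] arctan_bounded[of "f x"] arctan_bounded[of "g x"]
        show "x \<in> fst (upper_mixed f g a v)" if "x \<in> fst (level_pair f u)"
          using facts that unfolding pair_simps by argo
        show "x \<in> snd (upper_mixed f g a v)" if "x \<in> snd (level_pair f u)"
          using facts that unfolding pair_simps by argo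
      qed (auto simp: level_pair_simps)
      then show ?thesis ..
    qed
    then show ?thesis
      using eq False mv_through_zero[OF cvu z] by auto
  qed
qed

text \<open>\<open>alpha\<close> acts on each coordinate separately, so it carries corners of
  rectangles to corners, and the cover for f refines the one for g.\<close>

lemma rect_mv_shift:
  assumes sb: "shift_bounded f g a"
    and D: "u \<in> fund_D" "v \<in> fund_D" "alpha a u \<in> fund_D" "alpha a v \<in> fund_D"
    and le: "u \<preceq> strip_T v" "v \<preceq> u" and z: "z \<in> carrier (hcoh (n - 1) (level_pair g (alpha a v)))"
  shows "restr n (level_pair f u) (level_pair g (alpha a u)) (rect_mv g n (alpha a u) (alpha a v) z) =
    rect_mv f n u v (restr (n - 1) (level_pair f v) (level_pair g (alpha a v)) z)"
proof -
  note f = shift_boundedD(1)[OF sb] and g = shift_boundedD(2)[OF sb]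
  have le': "alpha a u \<preceq> strip_T (alpha a v)" "alpha a v \<preceq> alpha a u"
    using le by (simp_all add: strip_T_alpha_le_iff)
  note cv = rect_cover[OF f D(1,2) le] and cv' = rect_cover[OF g D(3,4) le']
  note su = level_pair_shift[OF sb, of u] and sv = level_pair_shift[OF sb, of v]
  note ou = open_level_pair_D[OF f D(1)] and ov = open_level_pair_D[OF g D(4)]
  have "mv_through n (level_pair f u) (level_pair g (fst (alpha a u), snd (alpha a v)))
        (level_pair g (fst (alpha a v), snd (alpha a u))) (level_pair g (alpha a v)) z =
      mv_through n (level_pair f u) (level_pair f (fst u, snd v)) (level_pair f (fst v, snd u))
        (level_pair g (alpha a v)) z"
    using level_pair_shift[OF sb, of "(fst u, snd v)"] level_pair_shift[OF sb, of "(fst v, snd u)"]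
    by (intro mv_through_refine z mv_cover_mono[OF cv ou pair_le_refl ov sv]
        mv_cover_mono[OF cv' ou su ov pair_le_refl]) (simp_all add: alpha_def)
  then show ?thesis
    using restr_mv_through[OF cv' z ou su] mv_through_restr[OF cv z ov sv] by simp
qed

text \<open>The mixed pairs are monotone in the point, so the cover at u refines the cover at
  v.\<close>

lemma mixed_mv_restr_mixed_mv:
  assumes sb: "shift_bounded f g a"
    and D: "u \<in> fund_D" "v \<in> fund_D" "alpha a u \<notin> fund_D" "alpha a v \<notin> fund_D"
    and le: "u \<preceq> v" and z: "z \<in> carrier (hcoh (n - 1) (level_pair g (strip_T_inv (alpha a v))))"
  shows "mixed_mv f g a n u (restr (n - 1) (level_pair g (strip_T_inv (alpha a u)))
      (level_pair g (strip_T_inv (alpha a v))) z) =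
    restr n (level_pair f u) (level_pair f v) (mixed_mv f g a n v z)"
proof -
  note f = shift_boundedD(1)[OF sb]
  note cv = mixed_cover[OF sb D(1,3)] and cv' = mixed_cover[OF sb D(2,4)]
  note lu = level_pair_mono[OF le, of f]
  have le_a: "alpha a u \<preceq> alpha a v"
    using le by simp
  then have lv: "pair_le (level_pair g (strip_T_inv (alpha a u))) (level_pair g (strip_T_inv (alpha a v)))"
    by (intro level_pair_mono) simp
  note ou = open_level_pair_D[OF f D(1)] and ov = mv_coverD(4)[OF cv']
  have "mv_through n (level_pair f u) (lower_mixed f g a v) (upper_mixed f g a v)
        (level_pair g (strip_T_inv (alpha a v))) z =
      mv_through n (level_pair f u) (lower_mixed f g a u) (upper_mixed f g a u)
        (level_pair g (strip_T_inv (alpha a v))) z"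
    using le le_a
    by (intro mv_through_refine z mv_cover_mono[OF cv ou pair_le_refl ov lv]
        mv_cover_mono[OF cv' ou lu ov pair_le_refl])
      (auto simp: pair_le_def mixed_simps strip_le_def simp del: alpha_simps)
  then show ?thesis
    using restr_mv_through[OF cv' z ou lu] mv_through_restr[OF cv z ov lv] by simp
qed

text \<open>The square in which u leaves D and v, one tile away, does not, so that the images share
  a tile. Here the covers are compared from the source side: the cross intersections lie in the pair
  of g at \<open>alpha a v\<close>, and in the vanishing case a whole mixed member does.\<close>

lemma mixed_mv_restr:
  assumes sb: "shift_bounded f g a"
    and D: "u \<in> fund_D" "v \<in> fund_D" "alpha a u \<notin> fund_D" "alpha a v \<in> fund_D"
    and le: "u \<preceq> strip_T v" and z: "z \<in> carrier (hcoh (n - 1) (level_pair g (alpha a v)))"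
  shows "mixed_mv f g a n u (restr (n - 1) (level_pair g (strip_T_inv (alpha a u)))
      (level_pair g (alpha a v)) z) =
    (if v \<preceq> u then rect_mv f n u v (restr (n - 1) (level_pair f v) (level_pair g (alpha a v)) z)
     else \<zero>\<^bsub>hcoh n (level_pair f u)\<^esub>)"
proof -
  note f = shift_boundedD(1)[OF sb] and g = shift_boundedD(2)[OF sb]
  note leave = alpha_leaves_fund_D[OF shift_boundedD(3)[OF sb] D(1,3)]
  have le_a: "alpha a u \<preceq> strip_T (alpha a v)" "strip_T_inv (alpha a u) \<preceq> alpha a v"
    using le by (simp_all add: strip_T_alpha_le_iff strip_T_inv_le_iff')
  have diag: "snd u \<le> fst u"
    using D(1) by (simp add: fund_D_iff)
  note arith = le[unfolded strip_le_def strip_T_simps] le_a(1)[unfolded strip_le_def strip_T_simps]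
    leave(1,3-10) diag
  note cv = mixed_cover[OF sb D(1,3)]
  note ou = open_level_pair_D[OF f D(1)] and ov = open_level_pair_D[OF g D(4)]
  note lq = level_pair_mono[OF le_a(2), of g]
  note eq = mv_through_restr[OF cv z ov lq]
  note cv_v = mv_cover_mono[OF cv ou pair_le_refl ov lq]
  show ?thesis
  proof (cases "v \<preceq> u")
    case True
    note cv' = rect_cover[OF f D(1,2) le True]
    note sv = level_pair_shift[OF sb, of v]
    have "mv_through n (level_pair f u) (lower_mixed f g a u) (upper_mixed f g a u) (level_pair g (alpha a v)) z =
      mv_through n (level_pair f u) (level_pair f (fst u, snd v)) (level_pair f (fst v, snd u))
        (level_pair g (alpha a v)) z"
    proof (rule mv_through_eqI'[OF cv_v mv_cover_mono[OF cv' ou pair_le_refl ov sv] z],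
        rule pair_leI, goal_cases)
      case (3 x)
      from 3 arith shift_bounds[OF sb 3(1), of v] arctan_bounded[of "f x"] arctan_bounded[of "g x"]
      show ?case unfolding pair_simps by argo
    next
      case (4 x)
      from 4 arith shift_bounds[OF sb 4(1), of v] arctan_bounded[of "f x"] arctan_bounded[of "g x"]
      show ?case unfolding pair_simps by argo
    qed (auto simp: pair_simps)
    then show ?thesis
      using eq True mv_through_restr[OF cv' z ov sv] by simp
  next
    case False
    then consider "fst v < fst u" | "snd u < snd v"
      by (auto simp: strip_le_def)
    then have "pair_le (lower_mixed f g a u) (level_pair g (alpha a v)) \<or>
      pair_le (upper_mixed f g a u) (level_pair g (alpha a v))"
    proof cases
      case 1
      then have 1: "fst v < fst u" "fst (alpha a v) < fst (alpha a u)"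
        by simp_all
      have "pair_le (lower_mixed f g a u) (level_pair g (alpha a v))"
      proof (rule pair_leI, goal_cases)
        case (3 x)
        from 1 3 arith shift_bounds[OF sb 3(1), of v] arctan_bounded[of "f x"] arctan_bounded[of "g x"]
        show ?case unfolding pair_simps by argo
      next
        case (4 x)
        from 1 4 arith shift_bounds[OF sb 4(1), of v] arctan_bounded[of "f x"] arctan_bounded[of "g x"]
        show ?case unfolding pair_simps by argo
      qed (auto simp: pair_simps)
      then show ?thesis ..
    next
      case 2
      then have 2: "snd u < snd v" "snd (alpha a u) < snd (alpha a v)"
        by simp_all
      have "pair_le (upper_mixed f g a u) (level_pair g (alpha a v))"
      proof (rule pair_leI, goal_cases)
        case (3 x)
        from 2 3 arith shift_bounds[OF sb 3(1), of v] arctan_bounded[of "f x"] arctan_bounded[of "g x"]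
        show ?case unfolding pair_simps by argo
      next
        case (4 x)
        from 2 4 arith shift_bounds[OF sb 4(1), of v] arctan_bounded[of "f x"] arctan_bounded[of "g x"]
        show ?case unfolding pair_simps by argo
      qed (auto simp: pair_simps)
      then show ?thesis ..
    qed
    then show ?thesis
      using eq False mv_through_zero[OF cv_v z] by auto
  qed
qed

text \<open>Neither composite vanishes in general. They agree because \<open>g\<^sup>-\<^sup>1(\<rho>(T\<^sup>-\<^sup>1(\<alpha>\<^sub>a(u))))\<close>
  is contained in \<open>f\<^sup>-\<^sup>1(\<rho>(v))\<close>, which lets the inner differential on the left factor through
  the one on the right.\<close>

lemma mixed_mv_rect_mv:
  assumes sb: "shift_bounded f g a"
    and D: "u \<in> fund_D" "v \<in> fund_D" "alpha a u \<notin> fund_D" "alpha a v \<notin> fund_D"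
    and le: "u \<preceq> strip_T v" "v \<preceq> u"
    and z: "z \<in> carrier (hcoh (n - 1 - 1) (level_pair g (strip_T_inv (alpha a v))))"
  shows "mixed_mv f g a n u (rect_mv g (n - 1) (strip_T_inv (alpha a u)) (strip_T_inv (alpha a v)) z) =
    rect_mv f n u v (mixed_mv f g a (n - 1) v z)"
proof -
  note f = shift_boundedD(1)[OF sb] and g = shift_boundedD(2)[OF sb]
  note leave = alpha_leaves_fund_D[OF shift_boundedD(3)[OF sb] D(1,3)]
    and leave' = alpha_leaves_fund_D[OF shift_boundedD(3)[OF sb] D(2,4)]
  let ?q = "strip_T_inv (alpha a u)" and ?p = "strip_T_inv (alpha a v)"
  have le_a: "?q \<preceq> strip_T ?p" "?p \<preceq> ?q" "alpha a v \<preceq> alpha a u"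
    using le by (simp_all add: strip_T_inv_le_iff' strip_T_alpha_le_iff)
  have diag: "snd u \<le> fst u"
    using D(1) by (simp add: fund_D_iff)
  note arith = diag le[unfolded strip_le_def strip_T_simps] le_a(3)[unfolded strip_le_def]
    leave(1,3-10) leave'(1,3-10)
  note cu = mixed_cover[OF sb D(1,3)] and cv = mixed_cover[OF sb D(2,4)]
    and cpq = rect_cover[OF g leave(2) leave'(2) le_a(1,2)] and cuv = rect_cover[OF f D(1,2) le]
  note ou = mv_coverD(1)[OF cu] and oq = mv_coverD(4)[OF cu] and ov = mv_coverD(1)[OF cv]
  define y where "y = mixed_mv f g a (n - 1) v z"
  have y: "y \<in> carrier (hcoh (n - 1) (level_pair f v))"
    unfolding y_def by (rule mv_through_in[OF cv z])
  have lqv: "pair_le (level_pair g ?q) (level_pair f v)"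
  proof (rule pair_leI, goal_cases)
    case (3 x)
    from 3 arith arctan_bounded[of "f x"] arctan_bounded[of "g x"]
    show ?case unfolding pair_simps by argo
  next
    case (4 x)
    from 4 arith arctan_bounded[of "f x"] arctan_bounded[of "g x"]
    show ?case unfolding pair_simps by argo
  qed (auto simp: pair_simps)
  have "rect_mv g (n - 1) ?q ?p z =
      mv_through (n - 1) (level_pair g ?q) (lower_mixed f g a v) (upper_mixed f g a v) (level_pair g ?p) z"
  proof (rule mv_through_eqI[OF cpq mv_cover_mono[OF cv oq lqv mv_coverD(4)[OF cv] pair_le_refl] z],
      rule pair_leI, goal_cases)
    case (3 x)
    from 3 arith arctan_bounded[of "f x"] arctan_bounded[of "g x"]
    show ?case unfolding pair_simps by (smt (verit))
  next
    case (4 x)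
    from 4 arith arctan_bounded[of "f x"] arctan_bounded[of "g x"]
    show ?case unfolding pair_simps by argo
  qed (auto simp: pair_simps)
  also have "\<dots> = restr (n - 1) (level_pair g ?q) (level_pair f v) y"
    using restr_mv_through[OF cv z oq lqv] by (simp add: y_def)
  finally have "mixed_mv f g a n u (rect_mv g (n - 1) ?q ?p z) =
      mv_through n (level_pair f u) (lower_mixed f g a u) (upper_mixed f g a u) (level_pair f v) y"
    using mv_through_restr[OF cu y ov lqv] by simp
  also have "\<dots> = rect_mv f n u v y"
  proof (rule mv_through_eqI[OF mv_cover_mono[OF cu ou pair_le_refl ov lqv] cuv y],
      rule pair_leI, goal_cases)
    case (3 x)
    from 3 arith arctan_bounded[of "f x"] arctan_bounded[of "g x"]
    show ?case unfolding pair_simps by argo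
  next
    case (4 x)
    from 4 arith arctan_bounded[of "f x"] arctan_bounded[of "g x"]
    show ?case unfolding pair_simps by argo
  qed (auto simp: pair_simps)
  finally show ?thesis
    by (simp add: y_def)
qed

section \<open>Round trips that raise the degree once\<close>

text \<open>The round trip in which the second shift leaves D. Over the pair of f at u, the mixed
  cover at \<open>alpha a u\<close> and the rectangle cover of f have a common refinement.\<close>

lemma rect_mv_via_upper:
  assumes sb: "shift_bounded f g a" and sb': "shift_bounded g f b"
    and D: "u \<in> fund_D" "alpha a u \<in> fund_D" "alpha b (alpha a u) \<notin> fund_D"
    and le: "u \<preceq> alpha b (alpha a u)"
    and z: "z \<in> carrier (hcoh (n - 1) (level_pair f (strip_T_inv (alpha b (alpha a u)))))"
  shows "restr n (level_pair f u) (level_pair g (alpha a u)) (mixed_mv g f b n (alpha a u) z) =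
    rect_mv f n u (strip_T_inv (alpha b (alpha a u))) z"
    and "strip_T_inv (alpha b (alpha a u)) \<preceq> u"
proof -
  let ?q = "strip_T_inv (alpha b (alpha a u))"
  note f = shift_boundedD(1)[OF sb]
  note leave = alpha_leaves_fund_D[OF shift_boundedD(3)[OF sb'] D(2,3)]
  \<comment> \<open>The lines x = pi/2 and y = -pi/2 are invariant under \<open>alpha a\<close>, so
    the bounds known at \<open>alpha a u\<close> hold at u as well.\<close>
  have "fst u < pi / 2" "- pi / 2 < snd u"
    using alpha_square(1,4)[of u a] leave(3,6) by linarith+
  note arith = le[unfolded strip_le_def] this leave(1,3-10)
  show qu: "?q \<preceq> u"
    using arith unfolding strip_le_def strip_T_inv_simps by linarith
  have uq: "u \<preceq> strip_T ?q"
    using le by simp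
  note ou = open_level_pair_D[OF f D(1)] and su = level_pair_shift[OF sb, of u]
  note cv = mixed_cover[OF sb' D(2,3)] and cv' = rect_cover[OF f D(1) leave(2) uq qu]
  note cvu = mv_cover_mono[OF cv ou su mv_coverD(4)[OF cv] pair_le_refl]
  have "mv_through n (level_pair f u) (lower_mixed g f b (alpha a u)) (upper_mixed g f b (alpha a u))
      (level_pair f ?q) z = rect_mv f n u ?q z"
  proof (rule mv_through_eqI[OF cvu cv' z], rule pair_leI, goal_cases)
    case (3 x)
    from 3 arith shift_bounds[OF sb 3(1), of u] arctan_bounded[of "f x"] arctan_bounded[of "g x"]
    show ?case unfolding pair_simps by (smt (verit))
  next
    case (4 x)
    from 4 arith shift_bounds[OF sb 4(1), of u] arctan_bounded[of "f x"] arctan_bounded[of "g x"]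
    show ?case unfolding pair_simps by argo
  qed (auto simp: pair_simps)
  then show "restr n (level_pair f u) (level_pair g (alpha a u)) (mixed_mv g f b n (alpha a u) z) =
      rect_mv f n u ?q z"
    using restr_mv_through[OF cv z ou su] by simp
qed

text \<open>The round trip in which the first shift leaves D. The restriction on the source side is
  absorbed into the mixed cover at u, which is then compared with the rectangle cover of f.\<close>

lemma rect_mv_via_lower:
  assumes sb: "shift_bounded f g a" and sb': "shift_bounded g f b"
    and D: "u \<in> fund_D" "alpha a u \<notin> fund_D" "strip_T_inv (alpha b (alpha a u)) \<in> fund_D"
    and le: "u \<preceq> alpha b (alpha a u)"
    and z: "z \<in> carrier (hcoh (n - 1) (level_pair f (strip_T_inv (alpha b (alpha a u)))))"
  shows "mixed_mv f g a n u (restr (n - 1) (level_pair g (strip_T_inv (alpha a u)))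
      (level_pair f (strip_T_inv (alpha b (alpha a u)))) z) =
    rect_mv f n u (strip_T_inv (alpha b (alpha a u))) z"
    and "strip_T_inv (alpha b (alpha a u)) \<preceq> u"
proof -
  let ?q = "strip_T_inv (alpha b (alpha a u))"
  note f = shift_boundedD(1)[OF sb]
  note leave = alpha_leaves_fund_D[OF shift_boundedD(3)[OF sb] D(1,2)]
  have sq: "- pi / 2 \<le> fst (alpha b (alpha a u))" "snd (alpha b (alpha a u)) \<le> pi / 2"
    using alpha_square(2,3)[of "alpha a u" b] leave(7-10) by linarith+
  have upper: "fst (alpha b (alpha a u)) < snd (alpha b (alpha a u))"
    using D(3) by (auto simp: fund_D_iff)
  note arith = le[unfolded strip_le_def] sq upper leave(1,3-10)
  show qu: "?q \<preceq> u"
    using arith unfolding strip_le_def strip_T_inv_simps by linarith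
  have uq: "u \<preceq> strip_T ?q"
    using le by simp
  have lq: "pair_le (level_pair g (strip_T_inv (alpha a u))) (level_pair f ?q)"
    using level_pair_shift[OF sb', of "strip_T_inv (alpha a u)"] by (simp only: alpha_T_inv)
  note oq = open_level_pair_D[OF f D(3)]
  note cv = mixed_cover[OF sb D(1,2)] and cv' = rect_cover[OF f D(1,3) uq qu]
  note cvq = mv_cover_mono[OF cv mv_coverD(1)[OF cv] pair_le_refl oq lq]
  have "mv_through n (level_pair f u) (lower_mixed f g a u) (upper_mixed f g a u) (level_pair f ?q) z =
      rect_mv f n u ?q z"
  proof (rule mv_through_eqI[OF cvq cv' z], rule pair_leI, goal_cases)
    case (3 x)
    from 3 arith shift_bounds[OF sb' 3(1), of "alpha a u"] arctan_bounded[of "f x"] arctan_bounded[of "g x"]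
    show ?case unfolding pair_simps by argo
  next
    case (4 x)
    from 4 arith shift_bounds[OF sb' 4(1), of "alpha a u"] arctan_bounded[of "f x"] arctan_bounded[of "g x"]
    show ?case unfolding pair_simps by argo
  qed (auto simp: pair_simps)
  then show "mixed_mv f g a n u (restr (n - 1) (level_pair g (strip_T_inv (alpha a u)))
      (level_pair f ?q) z) = rect_mv f n u ?q z"
    using mv_through_restr[OF cv z oq lq] by simp
qed

section \<open>From representatives to arbitrary points of the strip\<close>

lemma vec_h_same:
  assumes "u \<in> strip" and "tile (alpha (dist_pair X f g) u) = tile u"
  shows "vec_h C X f g u = restr (tile u) (level_pair f (rep u))
    (level_pair g (rep (alpha (dist_pair X f g) u)))"
  using rep_alpha_same[OF assms] by (simp add: vec_h_def Let_def alpha_image_iff level_pair_def)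

lemma vec_h_shift:
  assumes sb: "shift_bounded f g (dist_pair X f g)"
    and u: "u \<in> strip" "tile (alpha (dist_pair X f g) u) \<noteq> tile u"
    and z: "z \<in> carrier (fobj (h C X g) (alpha (dist_pair X f g) u))"
  shows "vec_h C X f g u z = mixed_mv f g (dist_pair X f g) (tile u) (rep u) z"
proof -
  let ?a = "dist_pair X f g"
  let ?\<xi> = "\<lambda>q. ({x \<in> topspace X. g x \<in> rho1 (alpha ?a q)}, {x \<in> topspace X. f x \<in> rho0 q})"
  note shift = rep_alpha_shift[OF shift_boundedD(3)[OF sb] u]
  have D: "rep u \<in> fund_D"
    using rep_in_fund_D[OF u(1)] .
  note leave = alpha_leaves_fund_D[OF shift_boundedD(3)[OF sb] D shift(3)]
  note arith = leave(3-10)[unfolded alpha_simps]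
  \<comment> \<open>The lower left corner on the boundary has second coordinate
    \<open>- pi - fst (rep u)\<close>; periodicity expresses its image through the first coordinate
    of the image of \<open>rep u\<close>.\<close>
  have per: "g_tilde ?a (- pi - fst (rep u)) = g_tilde ?a (pi - fst (rep u)) - 2 * pi"
    using g_tilde_periodic[of ?a "- pi - fst (rep u)"] by simp
  have lower: "?\<xi> (fst (rep u), - pi - fst (rep u)) = lower_mixed f g ?a (rep u)"
  proof (rule pair_eqI, goal_cases)
    case (5 x)
    from 5 arith arctan_bounded[of "f x"] arctan_bounded[of "g x"] show ?case
      unfolding pair_simps rho1_def rho0_def alpha_simps per by argo
  next
    case (6 x)
    from 6 arith arctan_bounded[of "f x"] arctan_bounded[of "g x"] show ?case
      unfolding pair_simps rho1_def rho0_def alpha_simps per by argo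
  qed (auto simp: pair_simps)
  have upper: "?\<xi> (pi - snd (rep u), snd (rep u)) = upper_mixed f g ?a (rep u)"
  proof (rule pair_eqI, goal_cases)
    case (5 x)
    from 5 arith arctan_bounded[of "f x"] arctan_bounded[of "g x"] show ?case
      unfolding pair_simps rho1_def rho0_def alpha_simps diff_diff_eq2 by argo
  next
    case (6 x)
    from 6 arith arctan_bounded[of "f x"] arctan_bounded[of "g x"] show ?case
      unfolding pair_simps rho1_def rho0_def alpha_simps by argo
  qed (auto simp: pair_simps)
  have "vec_h C X f g u z =
      mv_diff C (tile u) X (lower_mixed f g ?a (rep u)) (upper_mixed f g ?a (rep u)) z"
    using shift(3) lower upper
    by (simp add: vec_h_def Let_def alpha_image_iff mv_rect_def del: alpha_simps)
  also have "\<dots> = mixed_mv f g ?a (tile u) (rep u) z"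
    using mv_diff_eq_mv_through[OF open_mixed[OF sb]] z mixed_un[OF sb D shift(3)]
      mixed_int[OF sb D shift(3)]
    by (simp add: h_obj shift(1,2)[symmetric] del: alpha_simps)
  finally show ?thesis .
qed

lemma vec_h_linear:
  assumes sb: "shift_bounded f g (dist_pair X f g)" and u: "u \<in> strip"
  shows "linear_map K (fobj (h C X g) (alpha (dist_pair X f g) u)) (fobj (h C X f) u) (vec_h C X f g u)"
proof (cases "tile (alpha (dist_pair X f g) u) = tile u")
  case True
  note f = shift_boundedD(1)[OF sb] and g = shift_boundedD(2)[OF sb]
  have "pair_le (level_pair f (rep u)) (level_pair g (rep (alpha (dist_pair X f g) u)))"
    using level_pair_shift[OF sb, of "rep u"] by (simp only: rep_alpha_same(1)[OF u True])
  from restr_linear[OF open_rep[OF f u] open_rep[OF g alpha_in_strip[OF u]] this, of "tile u"]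
  show ?thesis
    by (simp only: vec_h_same[OF u True] h_obj True)
next
  case False
  note shift = rep_alpha_shift[OF shift_boundedD(3)[OF sb] u False]
  have "linear_map K (fobj (h C X g) (alpha (dist_pair X f g) u)) (fobj (h C X f) u)
      (mixed_mv f g (dist_pair X f g) (tile u) (rep u))"
    using mv_through_linear[OF mixed_cover[OF sb rep_in_fund_D[OF u] shift(3)]]
    by (simp only: h_obj shift(1) strip_T_pow_normalize)
  then show ?thesis
    using vec_h_shift[OF sb u False]
    by (rule linear_map_cong) (auto intro: module_h shift_boundedD(2)[OF sb] alpha_in_strip u)
qed

lemma vec_h_square:
  assumes sb: "shift_bounded f g (dist_pair X f g)"
    and u: "u \<in> strip" and v: "v \<in> strip" and uv: "u \<preceq> v"
    and z: "z \<in> carrier (fobj (h C X g) (alpha (dist_pair X f g) v))"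
  shows "vec_h C X f g u (fmap (h C X g) (alpha (dist_pair X f g) u) (alpha (dist_pair X f g) v) z) =
    fmap (h C X f) u v (vec_h C X f g v z)"
proof -
  define a where "a = dist_pair X f g"
  note sb = sb[folded a_def] and z = z[folded a_def]
  note f = shift_boundedD(1)[OF sb] and g = shift_boundedD(2)[OF sb]
  note au = alpha_in_strip[OF u, of a] and av = alpha_in_strip[OF v, of a]
  have uv_a: "alpha a u \<preceq> alpha a v"
    using uv by simp
  have le_T: "alpha a v \<preceq> strip_T (alpha a u) \<longleftrightarrow> v \<preceq> strip_T u"
    by (rule strip_T_alpha_le_iff)
  have mono: "tile v \<le> tile u" "tile (alpha a v) \<le> tile (alpha a u)"
    using tile_antimono u v uv au av uv_a by blast+
  note shift = rep_alpha_shift[OF shift_boundedD(3)[OF sb]]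
  note vec_same = vec_h_same[of _ f g, folded a_def]
    and vec_shift = vec_h_shift[of f g, folded a_def, OF sb]
    and vec_lin = vec_h_linear[of f g, folded a_def, OF sb]
  note gz = linear_map_in_carrier[OF h_map_linear[OF g au av uv_a] z]
    and vz = linear_map_in_carrier[OF vec_lin[OF v] z]
  note Du = rep_in_fund_D[OF u] and Dv = rep_in_fund_D[OF v]
  have tri: "tile (alpha a u) = tile u \<or> tile (alpha a u) = tile u - 1"
      "tile (alpha a v) = tile v \<or> tile (alpha a v) = tile v - 1"
    using shift(1) u v by blast+
  \<comment> \<open>Each image is in the tile of its point or the next one. Within one tile u cannot
    leave alone, by monotonicity. If v is one tile away and only v leaves, the images are two tiles
    apart, so v is not below T(u) and both internal maps are zero.\<close>
  consider (inner) "tile v = tile u" "tile (alpha a u) = tile u" "tile (alpha a v) = tile v"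
    | (leave) "tile v = tile u" "tile (alpha a u) = tile u" "tile (alpha a v) \<noteq> tile v"
    | (outer) "tile v = tile u" "tile (alpha a u) \<noteq> tile u" "tile (alpha a v) \<noteq> tile v"
    | (cross) "tile v = tile u - 1" "tile (alpha a u) \<noteq> tile u" "tile (alpha a v) = tile v"
    | (rect) "tile v \<noteq> tile u" "v \<preceq> strip_T u" "tile (alpha a u) = tile u" "tile (alpha a v) = tile v"
    | (rect_outer) "tile v \<noteq> tile u" "v \<preceq> strip_T u" "tile (alpha a u) \<noteq> tile u" "tile (alpha a v) \<noteq> tile v"
    | (zero) "tile v \<noteq> tile u" "\<not> v \<preceq> strip_T u" "tile (alpha a v) \<noteq> tile (alpha a u)"
  proof -
    consider "tile v = tile u" | "tile v = tile u - 1" | "tile v < tile u - 1"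
      using mono by linarith
    then show thesis
    proof cases
      case 1
      then have "tile (alpha a u) = tile u \<or> tile (alpha a v) \<noteq> tile v"
        using tri mono by linarith
      with 1 show ?thesis
        using inner leave outer by blast
    next
      case 2
      have "tile (alpha a u) - 1 \<le> tile (alpha a v)" if "v \<preceq> strip_T u"
        using tile_ge_if_le_T[OF au av] that le_T by blast
      with 2 tri show ?thesis
        using cross rect rect_outer zero by (cases "v \<preceq> strip_T u") (force, linarith)
    next
      case 3
      have "\<not> v \<preceq> strip_T u"
        using tile_ge_if_le_T[OF u v] 3 by linarith
      with 3 tri show ?thesis
        by (intro zero) linarith+
    qed
  qed
  then have "vec_h C X f g u (fmap (h C X g) (alpha a u) (alpha a v) z) =
    fmap (h C X f) u v (vec_h C X f g v z)"
  proof cases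
    case inner
    note eqs = rep_alpha_same[OF u inner(2)] rep_alpha_same[OF v inner(3)]
    have l: "pair_le (level_pair f (rep u)) (level_pair g (rep (alpha a u)))"
      "pair_le (level_pair f (rep v)) (level_pair g (rep (alpha a v)))"
      using level_pair_shift[OF sb] by (simp_all only: eqs)
    have l': "pair_le (level_pair f (rep u)) (level_pair f (rep v))"
      "pair_le (level_pair g (rep (alpha a u))) (level_pair g (rep (alpha a v)))"
      using inner uv uv_a by (intro level_pair_mono; simp del: alpha_le_iff alpha_simps)+
    have t: "tile (alpha a v) = tile (alpha a u)"
      using inner by simp
    note o = open_rep[OF f u] open_rep[OF f v] open_rep[OF g au] open_rep[OF g av]
    have "z \<in> carrier (hcoh (tile u) (level_pair g (rep (alpha a v))))"
      using z inner by (simp only: h_obj)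
    from restr_restr[OF o(1,3,4) l(1) l'(2) this] restr_restr[OF o(1,2,4) l'(1) l(2) this]
    show ?thesis
      by (simp only: vec_same[OF u inner(2)] vec_same[OF v inner(3)] h_map_same[OF t]
          h_map_same[OF inner(1)] inner(1,2))
  next
    case leave
    note eqs = rep_alpha_same[OF u leave(2)] and sv = shift[OF v leave(3)]
    have z': "z \<in> carrier (hcoh (tile u - 1) (level_pair g (strip_T_inv (alpha a (rep v)))))"
      using z by (simp only: h_obj sv(1) leave(1) strip_T_pow_normalize)
    have le: "rep u \<preceq> rep v"
      using uv by (simp only: leave(1) strip_T_pow_le_iff)
    have cond: "strip_T_inv (rep v) \<preceq> rep u \<longleftrightarrow> v \<preceq> strip_T u"
      using strip_T_pow_le_iff[of "tile u" v "strip_T u"]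
      by (simp only: leave(1) strip_T_inv_le_iff' strip_T_pow_T)
    have R: "fmap (h C X f) u v (vec_h C X f g v z) = restr (tile u) (level_pair f (rep u)) (level_pair f (rep v))
        (mixed_mv f g a (tile u) (rep v) z)"
      using vec_shift[OF v leave(3) z] by (simp only: h_map_same[OF leave(1)] leave(1))
    note sq = restr_mixed_mv[OF sb Du Dv eqs(2) sv(3) le z', unfolded cond]
    have t: "tile (alpha a v) \<noteq> tile (alpha a u)"
      using leave sv(1) by simp
    show ?thesis
    proof (cases "v \<preceq> strip_T u")
      case True
      then have "fmap (h C X g) (alpha a u) (alpha a v) z =
          rect_mv g (tile u) (alpha a (rep u)) (strip_T_inv (alpha a (rep v))) z"
        using h_map_rect[OF g au av uv_a _ t z] unfolding le_T
        by (simp only: leave(1,2) sv(1) strip_T_pow_normalize)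
      with sq True R show ?thesis
        by (simp only: vec_same[OF u leave(2)] leave(1,2) if_True strip_T_pow_normalize)
    next
      case False
      then have "fmap (h C X g) (alpha a u) (alpha a v) z = \<zero>\<^bsub>fobj (h C X g) (alpha a u)\<^esub>"
        using h_map_zero[OF au av t] unfolding le_T by simp
      moreover have "vec_h C X f g u \<zero>\<^bsub>fobj (h C X g) (alpha a u)\<^esub> = \<zero>\<^bsub>fobj (h C X f) u\<^esub>"
        by (intro linear_map_zero[OF vec_lin[OF u]] module_h f g u au)
      ultimately show ?thesis
        using sq False R by (simp only: if_False h_obj)
    qed
  next
    case outer
    note su = shift[OF u outer(2)] and sv = shift[OF v outer(3)]
    have z': "z \<in> carrier (hcoh (tile u - 1) (level_pair g (strip_T_inv (alpha a (rep v)))))"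
      using z by (simp only: h_obj sv(1) outer(1) strip_T_pow_normalize)
    have le: "rep u \<preceq> rep v"
      using uv by (simp only: outer(1) strip_T_pow_le_iff)
    have t: "tile (alpha a v) = tile (alpha a u)"
      using outer(1) su(1) sv(1) by simp
    show ?thesis
      using mixed_mv_restr_mixed_mv[OF sb Du Dv su(3) sv(3) le z']
        vec_shift[OF u outer(2) gz] vec_shift[OF v outer(3) z]
      by (simp only: h_map_same[OF t] h_map_same[OF outer(1)] su(1) sv(1) outer(1) strip_T_pow_normalize)
  next
    case cross
    note su = shift[OF u cross(2)] and eqs = rep_alpha_same[OF v cross(3)]
    have z': "z \<in> carrier (hcoh (tile u - 1) (level_pair g (alpha a (rep v))))"
      using z by (simp only: h_obj cross(1,3) strip_T_pow_normalize)
    have le: "rep u \<preceq> strip_T (rep v)"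
      using uv rep_le_T_rep(1)[OF cross(1)] by simp
    have t: "tile (alpha a v) = tile (alpha a u)" "tile v \<noteq> tile u"
      using cross su(1) by simp_all
    have L: "vec_h C X f g u (fmap (h C X g) (alpha a u) (alpha a v) z) =
        mixed_mv f g a (tile u) (rep u) (restr (tile u - 1) (level_pair g (strip_T_inv (alpha a (rep u))))
          (level_pair g (alpha a (rep v))) z)"
      using vec_shift[OF u cross(2) gz] by (simp only: h_map_same[OF t(1)] su(1) cross(1,3) strip_T_pow_normalize)
    note sq = mixed_mv_restr[OF sb Du Dv su(3) eqs(2) le z', unfolded rep_le_T_rep(2)[OF cross(1)]]
    show ?thesis
    proof (cases "v \<preceq> strip_T u")
      case True
      with L sq h_map_rect[OF f u v uv True t(2) vz] show ?thesis
        by (simp only: if_True vec_same[OF v cross(3)] cross(1,3) strip_T_pow_normalize)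
    next
      case False
      with L sq h_map_zero[OF u v t(2) False, of f] show ?thesis
        by (simp only: if_False h_obj)
    qed
  next
    case rect
    note t = tile_eq_pred[OF u v uv rect(2,1)] and r = rep_rect[OF u v uv rect(2,1)]
    note eqs = rep_alpha_same[OF u rect(3)] and eqs' = rep_alpha_same[OF v rect(4)]
    have z': "z \<in> carrier (hcoh (tile u - 1) (level_pair g (alpha a (rep v))))"
      using z by (simp only: h_obj rect(4) t strip_T_pow_normalize)
    have t_a: "tile (alpha a v) \<noteq> tile (alpha a u)"
      using rect by simp
    show ?thesis
      using rect_mv_shift[OF sb r(1,2) eqs(2) eqs'(2) r(3,4) z']
        h_map_rect[OF f u v uv rect(2,1) vz] h_map_rect[OF g au av uv_a _ t_a z] rect(2)
      unfolding le_T
      by (simp only: vec_same[OF u rect(3)] vec_same[OF v rect(4)] rect(3,4) t strip_T_pow_normalize)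
  next
    case rect_outer
    note t = tile_eq_pred[OF u v uv rect_outer(2,1)] and r = rep_rect[OF u v uv rect_outer(2,1)]
    note su = shift[OF u rect_outer(3)] and sv = shift[OF v rect_outer(4)]
    have z': "z \<in> carrier (hcoh (tile u - 1 - 1) (level_pair g (strip_T_inv (alpha a (rep v)))))"
      using z by (simp only: h_obj sv(1) t strip_T_pow_normalize)
    have t_a: "tile (alpha a v) \<noteq> tile (alpha a u)"
      using t su(1) sv(1) by simp
    show ?thesis
      using mixed_mv_rect_mv[OF sb r(1,2) su(3) sv(3) r(3,4) z']
        vec_shift[OF u rect_outer(3) gz] vec_shift[OF v rect_outer(4) z]
        h_map_rect[OF f u v uv rect_outer(2,1) vz] h_map_rect[OF g au av uv_a _ t_a z] rect_outer(2)
      unfolding le_T by (simp only: su(1) sv(1) t strip_T_pow_normalize)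
  next
    case zero
    have "vec_h C X f g u \<zero>\<^bsub>fobj (h C X g) (alpha a u)\<^esub> = \<zero>\<^bsub>fobj (h C X f) u\<^esub>"
      by (intro linear_map_zero[OF vec_lin[OF u]] module_h f g u au)
    then show ?thesis
      using h_map_zero[OF u v zero(1,2), of f] h_map_zero[OF au av zero(3), of g] zero(2)
      by (simp only: le_T not_False_eq_True)
  qed
  then show ?thesis
    by (simp only: a_def)
qed

lemma vec_h_natural:
  assumes sb: "shift_bounded f g (dist_pair X f g)"
  shows "natural_transformation K (precompose (h C X g) (alpha (dist_pair X f g))) (h C X f) (vec_h C X f g)"
  unfolding natural_transformation_def
proof (intro conjI ballI impI)
  show "is_strip_functor K (precompose (h C X g) (alpha (dist_pair X f g)))"
    by (intro precompose_functor h_functor shift_boundedD(2)[OF sb] alpha_in_strip) simp_all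
  show "is_strip_functor K (h C X f)"
    by (rule h_functor[OF shift_boundedD(1)[OF sb]])
qed (use vec_h_linear[OF sb] vec_h_square[OF sb] in \<open>simp_all add: precompose_def\<close>)

lemma vec_h_vec_h:
  assumes sb: "shift_bounded f g (dist_pair X f g)" and sb': "shift_bounded g f (dist_pair X g f)"
    and u: "u \<in> strip"
    and le: "u \<preceq> alpha (dist_pair X g f) (alpha (dist_pair X f g) u)"
    and z: "z \<in> carrier (fobj (h C X f) (alpha (dist_pair X g f) (alpha (dist_pair X f g) u)))"
  shows "vec_h C X f g u (vec_h C X g f (alpha (dist_pair X f g) u) z) =
    fmap (h C X f) u (alpha (dist_pair X g f) (alpha (dist_pair X f g) u)) z"
proof -
  define a where "a = dist_pair X f g"
  define b where "b = dist_pair X g f"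
  note sb = sb[folded a_def] and sb' = sb'[folded b_def] and z = z[folded a_def b_def]
    and le = le[folded a_def b_def]
  note f = shift_boundedD(1)[OF sb] and g = shift_boundedD(2)[OF sb]
  define v where "v = alpha a u"
  define w where "w = alpha b v"
  have v: "v \<in> strip" and w: "w \<in> strip"
    by (simp_all add: v_def w_def alpha_in_strip u)
  have z: "z \<in> carrier (fobj (h C X f) w)" and uw: "u \<preceq> w"
    using z le by (simp_all only: v_def w_def)
  note same = vec_h_same[OF u, of f g, folded a_def v_def] vec_h_same[OF v, of g f, folded b_def w_def]
    and shift = vec_h_shift[of f g, folded a_def, OF sb u, folded v_def]
      vec_h_shift[of g f, folded b_def, OF sb' v, folded w_def]
  note vz = linear_map_in_carrier[OF vec_h_linear[of g f, folded b_def, OF sb' v] z[unfolded w_def]]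
  note Du = rep_in_fund_D[OF u] and Dv = rep_in_fund_D[OF v]
  note rep_same = rep_alpha_same[OF u, of a, folded v_def] rep_alpha_same[OF v, of b, folded w_def]
    and rep_shift = rep_alpha_shift[OF shift_boundedD(3)[OF sb] u, folded v_def]
      rep_alpha_shift[OF shift_boundedD(3)[OF sb'] v, folded w_def]
  have "vec_h C X f g u (vec_h C X g f v z) = fmap (h C X f) u w z"
  proof (cases "tile v = tile u"; cases "tile w = tile v")
    assume vu: "tile v = tile u" and wv: "tile w = tile v"
    have l: "pair_le (level_pair f (rep u)) (level_pair g (rep v))"
      "pair_le (level_pair g (rep v)) (level_pair f (rep w))"
      using level_pair_shift[OF sb, of "rep u"] level_pair_shift[OF sb', of "rep v"]
      by (simp_all only: rep_same(1)[OF vu] rep_same(3)[OF wv])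
    have wu: "tile w = tile u"
      using wv vu by simp
    have "z \<in> carrier (hcoh (tile u) (level_pair f (rep w)))"
      using z by (simp only: h_obj wu)
    from restr_restr[OF open_rep[OF f u] open_rep[OF g v] open_rep[OF f w] l this]
    show ?thesis
      by (simp only: same(1)[OF vu] same(2)[OF wv] h_map_same[OF wu] vu)
  next
    assume vu: "tile v = tile u" and wv: "tile w \<noteq> tile v"
    note s = rep_same(1,2)[OF vu] rep_shift(5-8)[OF wv]
    have t: "tile w = tile u - 1" "tile w \<noteq> tile u"
      using s(3) vu by simp_all
    have 1: "alpha b (alpha a (rep u)) \<notin> fund_D"
      using s(5) unfolding s(1) .
    have 2: "rep u \<preceq> alpha b (alpha a (rep u))"
      using uw by (simp only: alpha_T_pow strip_T_pow_le_iff v_def w_def)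
    have r: "rep w = strip_T_inv (alpha b (alpha a (rep u)))"
      using s(4) by (simp only: s(1))
    have 3: "z \<in> carrier (hcoh (tile u - 1) (level_pair f (strip_T_inv (alpha b (alpha a (rep u))))))"
      using z unfolding h_obj r unfolding t(1) .
    note via = rect_mv_via_upper[OF sb sb' Du s(2) 1 2 3]
    have wT: "w \<preceq> strip_T u"
      using via(2) rep_le_T_rep(2)[OF t(1)] by (simp only: r)
    show ?thesis
      unfolding same(1)[OF vu] shift(2)[OF wv z] h_map_rect[OF f u w uw wT t(2) z] r
      unfolding s(1) unfolding vu by (rule via(1))
  next
    assume vu: "tile v \<noteq> tile u" and wv: "tile w = tile v"
    note s = rep_shift(1-4)[OF vu] rep_same(3,4)[OF wv]
    have t: "tile w = tile u - 1" "tile w \<noteq> tile u"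
      using s(1) wv by simp_all
    have r: "rep w = strip_T_inv (alpha b (alpha a (rep u)))"
      using s(5) by (simp only: s(2) alpha_T_inv)
    have 1: "strip_T_inv (alpha b (alpha a (rep u))) \<in> fund_D"
      using s(6) by (simp only: s(2) alpha_T_inv)
    have 2: "rep u \<preceq> alpha b (alpha a (rep u))"
      using uw by (simp only: alpha_T_pow strip_T_pow_le_iff v_def w_def)
    have 3: "z \<in> carrier (hcoh (tile u - 1) (level_pair f (strip_T_inv (alpha b (alpha a (rep u))))))"
      using z unfolding h_obj r unfolding t(1) .
    note via = rect_mv_via_lower[OF sb sb' Du s(3) 1 2 3]
    have wT: "w \<preceq> strip_T u"
      using via(2) rep_le_T_rep(2)[OF t(1)] by (simp only: r)
    have "vec_h C X g f v z = restr (tile u - 1) (level_pair g (strip_T_inv (alpha a (rep u))))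
        (level_pair f (strip_T_inv (alpha b (alpha a (rep u))))) z"
      unfolding same(2)[OF wv] r unfolding s(2) unfolding s(1) ..
    then show ?thesis
      using via(1) h_map_rect[OF f u w uw wT t(2) z] shift(1)[OF vu vz[folded w_def]]
      by (simp only: r)
  next
    \<comment> \<open>Impossible: both departures start in the open square, but after the first one
      the representative is T^(-1) of a point of the square and has second coordinate below
      -pi/2.\<close>
    assume vu: "tile v \<noteq> tile u" and wv: "tile w \<noteq> tile v"
    note s = rep_shift(1-4)[OF vu] rep_shift(5-8)[OF wv]
    have "- pi / 2 < snd (rep v)"
      using alpha_leaves_fund_D(6)[OF shift_boundedD(3)[OF sb'] Dv s(7)] .
    moreover have "- pi / 2 < fst (alpha a (rep u))"
      using alpha_leaves_fund_D(8)[OF shift_boundedD(3)[OF sb] Du s(3)] .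
    ultimately have False
      unfolding s(2) strip_T_inv_simps by linarith
    then show ?thesis ..
  qed
  then show ?thesis
    by (simp only: a_def b_def v_def w_def)
qed

section \<open>The interleaving identities\<close>

lemma vec_h_shift_natural:
  assumes sb: "shift_bounded f g (dist_pair X f g)" and le: "dist_pair X f g \<preceq> (- \<delta>, \<delta>)"
  shows "natural_transformation K (precompose (h C X g) (Omega \<delta>)) (h C X f)
    (nt_comp (vec_h C X f g) (alpha_trans (h C X g) (dist_pair X f g) (- \<delta>, \<delta>)))"
proof -
  have "Omega \<delta> = alpha (- \<delta>, \<delta>)"
    by (simp add: Omega_def fun_eq_iff)
  then show ?thesis
    using nt_comp_natural[OF alpha_trans_natural[OF h_functor[OF shift_boundedD(2)[OF sb]] le]
        vec_h_natural[OF sb]] by simp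
qed

text \<open>Naturality of the inner transformation moves both restriction maps to the right, which
  reduces the claim to the composite of the two transformations themselves.\<close>

lemma vec_h_round_trip:
  assumes sb: "shift_bounded f g (dist_pair X f g)" and sb': "shift_bounded g f (dist_pair X g f)"
    and le: "dist_pair X f g \<preceq> (- \<delta>, \<delta>)" "dist_pair X g f \<preceq> (- \<delta>, \<delta>)"
    and le0: "(0, 0) \<preceq> dist_pair X g f + dist_pair X f g"
  shows "nt_eq (precompose (h C X f) (Omega (2 * \<delta>)))
    (nt_comp (nt_comp (vec_h C X f g) (alpha_trans (h C X g) (dist_pair X f g) (- \<delta>, \<delta>)))
      (whisker (nt_comp (vec_h C X g f) (alpha_trans (h C X f) (dist_pair X g f) (- \<delta>, \<delta>))) (Omega \<delta>)))
    (alpha_trans (h C X f) (0, 0) (- (2 * \<delta>), 2 * \<delta>))"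
  unfolding nt_eq_def
proof (intro ballI)
  fix u z assume u: "u \<in> strip" and "z \<in> carrier (fobj (precompose (h C X f) (Omega (2 * \<delta>))) u)"
  define a where "a = dist_pair X f g"
  define b where "b = dist_pair X g f"
  define d where "d = (- \<delta>, \<delta>)"
  have le: "a \<preceq> d" "b \<preceq> d"
    using le by (simp_all add: a_def b_def d_def)
  have dd: "(- (2 * \<delta>), 2 * \<delta>) = d + d"
    by (simp add: d_def)
  have z: "z \<in> carrier (fobj (h C X f) (alpha d (alpha d u)))"
    using \<open>z \<in> _\<close> by (simp add: precompose_def Omega_def dd alpha_add del: alpha_simps)
  note f = shift_boundedD(1)[OF sb] and g = shift_boundedD(2)[OF sb]
  note str = alpha_in_strip u
  define y where "y = fmap (h C X f) (alpha b (alpha d u)) (alpha d (alpha d u)) z"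
  have y: "y \<in> carrier (fobj (h C X f) (alpha b (alpha d u)))"
    unfolding y_def
    by (rule linear_map_in_carrier[OF h_map_linear[OF f] z]) (intro str alpha_mono_shift le)+
  have ba: "alpha b (alpha a u) \<preceq> alpha b (alpha d u)"
    using alpha_mono_shift[OF le(1), of u] by (simp only: alpha_le_iff)
  have 0: "u \<preceq> alpha b (alpha a u)"
    using alpha_mono_shift[OF le0, of u] by (simp only: alpha_0 alpha_add a_def b_def)
  have bd: "alpha b (alpha d u) \<preceq> alpha d (alpha d u)"
    by (rule alpha_mono_shift[OF le(2)])
  have ya: "fmap (h C X f) (alpha b (alpha a u)) (alpha b (alpha d u)) y \<in>
      carrier (fobj (h C X f) (alpha b (alpha a u)))"
    by (rule linear_map_in_carrier[OF h_map_linear[OF f _ _ ba] y]) (intro str)+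
  have "vec_h C X f g u (fmap (h C X g) (alpha a u) (alpha d u) (vec_h C X g f (alpha d u) y)) =
      vec_h C X f g u (vec_h C X g f (alpha a u)
        (fmap (h C X f) (alpha b (alpha a u)) (alpha b (alpha d u)) y))"
    using vec_h_square[OF sb' _ _ alpha_mono_shift[OF le(1)], of u y] y str
    by (simp only: b_def)
  also have "\<dots> = fmap (h C X f) u (alpha b (alpha a u))
      (fmap (h C X f) (alpha b (alpha a u)) (alpha b (alpha d u)) y)"
    using vec_h_vec_h[OF sb sb' u] 0 ya by (simp only: a_def b_def)
  also have "\<dots> = fmap (h C X f) u (alpha b (alpha d u)) y"
    by (rule h_map_comp[OF f _ _ _ 0 ba y, symmetric]) (intro str)+
  also have "\<dots> = fmap (h C X f) u (alpha d (alpha d u)) z"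
    unfolding y_def
    by (rule h_map_comp[OF f _ _ _ strip_le_trans[OF 0 ba] bd z, symmetric]) (intro str)+
  finally have "vec_h C X f g u (fmap (h C X g) (alpha a u) (alpha d u) (vec_h C X g f (alpha d u)
      (fmap (h C X f) (alpha b (alpha d u)) (alpha d (alpha d u)) z))) =
      fmap (h C X f) u (alpha d (alpha d u)) z"
    by (simp only: y_def)
  then show "nt_comp (nt_comp (vec_h C X f g) (alpha_trans (h C X g) (dist_pair X f g) (- \<delta>, \<delta>)))
      (whisker (nt_comp (vec_h C X g f) (alpha_trans (h C X f) (dist_pair X g f) (- \<delta>, \<delta>))) (Omega \<delta>)) u z =
    alpha_trans (h C X f) (0, 0) (- (2 * \<delta>), 2 * \<delta>) u z"
    by (simp only: nt_comp_def whisker_def alpha_trans_def comp_apply Omega_def alpha_0 dd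
        flip: a_def b_def d_def alpha_add)
qed

lemma shift_bounded_dist_pair:
  assumes "topspace X \<noteq> {}" and "continuous_map X euclideanreal f" and "continuous_map X euclideanreal g"
    and \<delta>: "\<forall>x\<in>topspace X. \<bar>f x - g x\<bar> \<le> \<delta>"
  shows "shift_bounded f g (dist_pair X f g)" and "dist_pair X f g \<preceq> (- \<delta>, \<delta>)"
proof -
  have bd: "bdd_below ((\<lambda>x. g x - f x) ` topspace X)" "bdd_above ((\<lambda>x. g x - f x) ` topspace X)"
    using \<delta> by (intro bdd_belowI2[of _ "- \<delta>"] bdd_aboveI2[of _ _ \<delta>]; fastforce)+
  then have le: "fst (dist_pair X f g) \<le> g x - f x \<and> g x - f x \<le> snd (dist_pair X f g)"
    if "x \<in> topspace X" for x
    using that unfolding dist_pair_def fst_conv snd_conv by (intro conjI cINF_lower cSUP_upper)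
  with assms(1) have "fst (dist_pair X f g) \<le> snd (dist_pair X f g)"
    by (meson all_not_in_conv order_trans)
  with le show "shift_bounded f g (dist_pair X f g)"
    using assms by (simp add: shift_bounded_def)
  have "- \<delta> \<le> g x - f x" "g x - f x \<le> \<delta>" if "x \<in> topspace X" for x
    using \<delta>[rule_format, OF that] by linarith+
  then show "dist_pair X f g \<preceq> (- \<delta>, \<delta>)"
    using assms(1) by (simp add: strip_le_def dist_pair_def cINF_greatest cSUP_least)
qed

end

text \<open>On the reals \<open>Inf\<close> is by definition the negative of the \<open>Sup\<close>
  of the negated set, which gives both components.\<close>

lemma dist_pair_swap: "dist_pair X g f = (- snd (dist_pair X f g), - fst (dist_pair X f g))"
proof -
  have "(\<lambda>x. f x - g x) ` topspace X = uminus ` (\<lambda>x. g x - f x) ` topspace X"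
    by (auto simp: image_image)
  then show ?thesis
    by (simp add: dist_pair_def Inf_real_def image_image)
qed

theorem theorem4p4:
  fixes K :: "('k, 'm) ring_scheme"
    and C :: "('a, 'k, 'v) cohomology"
    and X :: "'a topology"
    and f g :: "'a \<Rightarrow> real"
    and \<delta> :: real
    and a a' :: "real \<times> real"
  assumes "Ring.field K"
    and "cohomology_theory K C"
    and "relative_mayer_vietoris K C"
    and "topspace X \<noteq> {}"
    and "0 \<le> \<delta>"
    and "continuous_map X euclideanreal f"
    and "continuous_map X euclideanreal g"
    and "\<forall>x\<in>topspace X. \<bar>f x - g x\<bar> \<le> \<delta>"
    and "a = dist_pair X f g"
    and "a' = (- snd a, - fst a)"
  shows "interleaved K \<delta> (h C X f) (h C X g) \<and>
    a' = dist_pair X g f \<and> a \<preceq> (- \<delta>, \<delta>) \<and> a' \<preceq> (- \<delta>, \<delta>) \<and>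
    interleaving K \<delta> (h C X f) (h C X g)
      (nt_comp (vec_h C X f g) (alpha_trans (h C X g) a (- \<delta>, \<delta>)))
      (nt_comp (vec_h C X g f) (alpha_trans (h C X f) a' (- \<delta>, \<delta>)))"
proof -
  interpret mayer_vietoris_theory K C X
    using assms(2,3) by (rule mayer_vietoris_theory.intro)
  have a': "a' = dist_pair X g f"
    using assms(9,10) by (simp add: dist_pair_swap[of X g f])
  have "\<forall>x\<in>topspace X. \<bar>g x - f x\<bar> \<le> \<delta>"
    using assms(8) by (simp add: abs_minus_commute)
  note fg = shift_bounded_dist_pair[OF assms(4,6,7,8)]
    and gf = shift_bounded_dist_pair[OF assms(4,7,6) this]
  \<comment> \<open>With a = (a1, a2) the sum is (a1 - a2, a2 - a1), which is above (0, 0) because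
    a1 \<le> a2. Hence a round trip moves every point up, as the comparison with an internal map
    requires.\<close>
  have "(0, 0) \<preceq> dist_pair X g f + dist_pair X f g" "(0, 0) \<preceq> dist_pair X f g + dist_pair X g f"
    using shift_boundedD(3)[OF fg(1)] by (simp_all add: strip_le_def dist_pair_swap[of X g f])
  then have "interleaving K \<delta> (h C X f) (h C X g)
      (nt_comp (vec_h C X f g) (alpha_trans (h C X g) a (- \<delta>, \<delta>)))
      (nt_comp (vec_h C X g f) (alpha_trans (h C X f) a' (- \<delta>, \<delta>)))"
    unfolding interleaving_def a' assms(9)
    by (intro conjI vec_h_shift_natural vec_h_round_trip fg gf)
  moreover from this have "interleaved K \<delta> (h C X f) (h C X g)"
    unfolding interleaved_def by blast
  moreover have "a \<preceq> (- \<delta>, \<delta>)" "a' \<preceq> (- \<delta>, \<delta>)"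
    using fg(2) gf(2) by (simp_all only: a' assms(9))
  ultimately show ?thesis
    using a' by blast
qed

end
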